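(* Let $M,N\ge1$ and let $U^+_{M,N}$ be the subalgebra of $U_q(\mathcal{L}\mathfrak{sl}(M,N))$ generated by the $X_{i,n}^+$ ($1\le i\le M+N-1$, $n\in\mathbb{Z}$). Then the vector space $U^+_{M,N}$ is spanned by the vectors of the form $$\prod_{\beta\in\Delta_{M,N}}^{\rightarrow}\Big(\prod_{i=1}^{c_\beta}X_\beta(n_{i,\beta})\Big)$$ where $c_\beta\in\mathbb{Z}_{\ge0}$ for $\beta\in\Delta_{M,N}$ and $n_{i,\beta}\in\mathbb{Z}$ for $1\le i\le c_\beta$; the outer product is taken in increasing order from left to right with respect to the total order on $\Delta_{M,N}$.
   Context: The ground field is $\mathbb{C}$, $q\in\mathbb{C}\setminus\{0\}$ is not a root of unity, $M,N\ge1$ are integers. A superalgebra is an associative unital algebra with a compatible $\mathbb{Z}_2$-grading; for homogeneous $a,b$ put $[a,b]_u=ab-(-1)^{|a||b|}u\,ba$ and $[a,b]=[a,b]_1$. Put $[n]_p=\frac{p^n-p^{-n}}{p-p^{-1}}$. Let $l_i=1$ for $1\le i\le M$, $l_i=-1$ for $M+1\le i\le M+N$, $q_i=q^{l_i}$, $(\epsilon_i,\epsilon_j)=l_i\delta_{i,j}$ on $\bigoplus_{i=1}^{M+N}\mathbb{Z}\epsilon_i$, and $c_{i,j}=(\epsilon_i-\epsilon_{i+1},\epsilon_j-\epsilon_{j+1})$ for $1\le i,j\le M+N-1$. $U_q(\mathcal{L}\mathfrak{sl}(M,N))$ is the superalgebra with generators $X_{i,n}^{\pm},K_i^{\pm1},h_{i,s}$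 ($1\le i\le M+N-1$, $n\in\mathbb{Z}$, $s\in\mathbb{Z}_{\ne0}$), $X_{M,n}^{\pm}$ odd and all other generators even, and relations (all admissible indices): 1. $K_iK_i^{-1}=K_i^{-1}K_i=1$, $[K_i,K_j]=[K_i,h_{j,s}]=[h_{i,s},h_{j,t}]=0$; 2. $K_iX_{j,n}^{\pm}K_i^{-1}=q^{\pm c_{i,j}}X_{j,n}^{\pm}$, $[h_{i,s},X_{j,n}^{\pm}]=\pm\frac{[sl_ic_{i,j}]_{q_i}}{s}X_{j,n+s}^{\pm}$; 3. $[X_{i,m}^+,X_{j,n}^-]=\delta_{i,j}\frac{\phi_{i,m+n}^+-\phi_{i,m+n}^-}{q_i-q_i^{-1}}$, where $\sum_{n\in\mathbb{Z}}\phi_{i,n}^{\pm}z^n=K_i^{\pm1}\exp(\pm(q_i-q_i^{-1})\sum_{s>0}h_{i,\pm s}z^{\pm s})$ (a power series in $z^{\pm1}$); 4. $[X_{i,m}^{\pm},X_{j,n}^{\pm}]=0$ if $c_{i,j}=0$; 5. $X_{i,m+1}^{\pm}X_{j,n}^{\pm}-q^{\pm c_{i,j}}X_{j,n}^{\pm}X_{i,m+1}^{\pm}=q^{\pm c_{i,j}}X_{i,m}^{\pm}X_{j,n+1}^{\pm}-X_{j,n+1}^{\pm}X_{i,m}^{\pm}$ if $c_{i,j}\ne0$; 6. $[X_{i,m}^{\pm},[X_{i,n}^{\pm},X_{j,k}^{\pm}]_{q^{-1}}]_q+[X_{i,n}^{\pm},[X_{i,m}^{\pm},X_{j,k}^{\pm}]_{q^{-1}}]_q=0$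 if $c_{i,j}=\pm1$, $i\ne M$; 7. when $M,N>1$: $[[[X_{M-1,m}^{\pm},X_{M,n}^{\pm}]_{q^{-1}},X_{M+1,k}^{\pm}]_q,X_{M,u}^{\pm}]+[[[X_{M-1,m}^{\pm},X_{M,u}^{\pm}]_{q^{-1}},X_{M+1,k}^{\pm}]_q,X_{M,n}^{\pm}]=0$. Let $\alpha_1,\dots,\alpha_{M+N-1}$ be a basis of a free abelian group (simple roots), and $\Delta_{M,N}=\{\alpha_i+\alpha_{i+1}+\cdots+\alpha_j\mid 1\le i\le j\le M+N-1\}$, totally ordered by: $\alpha_i+\cdots+\alpha_j\le\alpha_{i'}+\cdots+\alpha_{j'}$ iff $i<i'$, or $i=i'$ and $j\le j'$. For $\beta=\alpha_i+\cdots+\alpha_j\in\Delta_{M,N}$ and $n\in\mathbb{Z}$ the root vector is $$X_\beta(n)=[\cdots[[X_{i,n}^+,X_{i+1,0}^+]_{q_{i+1}},X_{i+2,0}^+]_{q_{i+2}},\cdots,X_{j,0}^+]_{q_j},$$ with $X_{\alpha_i}(n)=X_{i,n}^+$. *)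

theory Defs
  imports
    "HOL-Algebra.Algebra"
    "HOL-Algebra.Algebraic_Closure_Type"
    "HOL-Computational_Algebra.Formal_Power_Series"
    "HOL-Library.Poly_Mapping"
    "HOL-Library.Product_Lexorder"
begin

section \<open>The free superalgebra on the generators\<close>

text \<open>Words are wrapped lists, so that \<open>'g word \<Rightarrow>\<^sub>0 complex\<close> with the convolution product of
  \<^theory>\<open>HOL-Library.Poly_Mapping\<close> is the free associative unital algebra on \<open>'g\<close>.\<close>

datatype 'g word = Word (letters: "'g list")

instantiation word :: (type) monoid_add
begin
definition zero_word :: "'a word" where "0 = Word []"
definition plus_word :: "'a word \<Rightarrow> 'a word \<Rightarrow> 'a word" where "v + w = Word (letters v @ letters w)"
instance by standard (simp_all add: zero_word_def plus_word_def)
end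

datatype pm = Pos | Neg

fun sg :: "pm \<Rightarrow> int" where
  "sg Pos = 1"
| "sg Neg = -1"

text \<open>\<open>Gen_X \<sigma> i n\<close>, \<open>Gen_K \<sigma> i\<close> and \<open>Gen_h i s\<close> stand for $X_{i,n}^{\sigma}$, $K_i^{\sigma 1}$
  and $h_{i,s}$.\<close>

datatype gen = Gen_X pm nat int | Gen_K pm nat | Gen_h nat int

type_synonym free = "gen word \<Rightarrow>\<^sub>0 complex"

definition gvar :: "gen \<Rightarrow> free" where
  "gvar g = Poly_Mapping.single (Word [g]) 1"

definition cst :: "complex \<Rightarrow> free" where
  "cst a = Poly_Mapping.single 0 a"

abbreviation Xgen :: "pm \<Rightarrow> nat \<Rightarrow> int \<Rightarrow> free" where "Xgen \<sigma> i n \<equiv> gvar (Gen_X \<sigma> i n)"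
abbreviation Kgen :: "pm \<Rightarrow> nat \<Rightarrow> free" where "Kgen \<sigma> i \<equiv> gvar (Gen_K \<sigma> i)"
abbreviation hgen :: "nat \<Rightarrow> int \<Rightarrow> free" where "hgen i s \<equiv> gvar (Gen_h i s)"

definition gens :: "nat \<Rightarrow> nat \<Rightarrow> gen set" where
  "gens M N =
     {Gen_X \<sigma> i n | \<sigma> i n. i \<in> {1..<M + N}} \<union>
     {Gen_K \<sigma> i | \<sigma> i. i \<in> {1..<M + N}} \<union>
     {Gen_h i s | i s. i \<in> {1..<M + N} \<and> s \<noteq> 0}"

text \<open>The type \<^typ>\<open>gen\<close> has more elements than there are generators for given \<open>M\<close>, \<open>N\<close>; the free
  algebra on the actual generators is cut out by the carrier.\<close>

definition free_algebra :: "nat \<Rightarrow> nat \<Rightarrow> free ring" where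
  "free_algebra M N = ring_of_type_algebra
     \<lparr>carrier := {a. \<forall>w \<in> Poly_Mapping.keys a. set (letters w) \<subseteq> gens M N}\<rparr>"

definition odd_gen :: "nat \<Rightarrow> gen \<Rightarrow> bool" where
  "odd_gen M g \<longleftrightarrow> (\<exists>\<sigma> n. g = Gen_X \<sigma> M n)"

definition parity :: "nat \<Rightarrow> gen word \<Rightarrow> nat" where
  "parity M w = length (filter (odd_gen M) (letters w)) mod 2"

definition homogeneous :: "nat \<Rightarrow> nat \<Rightarrow> free \<Rightarrow> bool" where
  "homogeneous M p a \<longleftrightarrow> (\<forall>w \<in> Poly_Mapping.keys a. parity M w = p)"

definition component :: "nat \<Rightarrow> nat \<Rightarrow> free \<Rightarrow> free" where
  "component M p a =
     (\<Sum>w \<in> {w \<in> Poly_Mapping.keys a. parity M w = p}.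
        Poly_Mapping.single w (Poly_Mapping.lookup a w))"

text \<open>The bracket $[a,b]_u$, extended bilinearly from homogeneous elements to all elements.\<close>

definition br :: "nat \<Rightarrow> complex \<Rightarrow> free \<Rightarrow> free \<Rightarrow> free" where
  "br M u a b =
     (\<Sum>p<2. \<Sum>r<2. component M p a * component M r b
        - cst ((-1) ^ (p * r) * u) * (component M r b * component M p a))"

lemma poly_mapping_sum_single:
  "(\<Sum>w \<in> Poly_Mapping.keys a. Poly_Mapping.single w (Poly_Mapping.lookup a w)) = a"
  by (rule poly_mapping_eqI) (auto simp: lookup_sum lookup_single when_def sum.delta in_keys_iff)

lemma component_homogeneous:
  assumes "homogeneous M p a"
  shows "component M r a = (if r = p then a else 0)"
proof (cases "r = p")
  case True
  with assms have *: "{w \<in> Poly_Mapping.keys a. parity M w = r} = Poly_Mapping.keys a"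
    by (auto simp: homogeneous_def)
  have "component M r a = a"
    unfolding component_def * by (rule poly_mapping_sum_single)
  with True show ?thesis by simp
next
  case False
  with assms have *: "{w \<in> Poly_Mapping.keys a. parity M w = r} = {}"
    by (auto simp: homogeneous_def)
  show ?thesis unfolding component_def * using False by simp
qed

lemma br_homogeneous:
  assumes "homogeneous M p a" "homogeneous M r b" "p < 2" "r < 2"
  shows "br M u a b = a * b - cst ((-1) ^ (p * r) * u) * (b * a)"
proof -
  have "p = 0 \<or> p = 1" "r = 0 \<or> r = 1" using assms(3,4) by auto
  then show ?thesis
    unfolding br_def numeral_2_eq_2
    by (auto simp: component_homogeneous[OF assms(1)] component_homogeneous[OF assms(2)])
qed


section \<open>The defining relations\<close>

definition ell :: "nat \<Rightarrow> nat \<Rightarrow> int" where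
  "ell M i = (if i \<le> M then 1 else -1)"

definition qi :: "complex \<Rightarrow> nat \<Rightarrow> nat \<Rightarrow> complex" where
  "qi q M i = q powi ell M i"

definition qint :: "complex \<Rightarrow> int \<Rightarrow> complex" where
  "qint p n = (p powi n - p powi (- n)) / (p - inverse p)"

definition eps_form :: "nat \<Rightarrow> nat \<Rightarrow> nat \<Rightarrow> int" where
  "eps_form M i j = (if i = j then ell M i else 0)"

text \<open>$(\epsilon_i-\epsilon_{i+1},\epsilon_j-\epsilon_{j+1})$, expanded bilinearly.\<close>

definition cform :: "nat \<Rightarrow> nat \<Rightarrow> nat \<Rightarrow> int" where
  "cform M i j = eps_form M i j - eps_form M i (j + 1) - eps_form M (i + 1) j + eps_form M (i + 1) (j + 1)"

text \<open>\<open>phi_series q M \<sigma> i\<close> is a power series in $z$ for \<open>\<sigma> = Pos\<close> and in $z^{-1}$ for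
  \<open>\<sigma> = Neg\<close>. The exponential of a series without constant term is the composition with
  $\sum_k z^k/k!$.\<close>

definition h_series :: "complex \<Rightarrow> nat \<Rightarrow> pm \<Rightarrow> nat \<Rightarrow> free fps" where
  "h_series q M \<sigma> i = Abs_fps (\<lambda>s. if s = 0 then 0
     else cst (of_int (sg \<sigma>) * (qi q M i - inverse (qi q M i))) * hgen i (sg \<sigma> * int s))"

definition phi_series :: "complex \<Rightarrow> nat \<Rightarrow> pm \<Rightarrow> nat \<Rightarrow> free fps" where
  "phi_series q M \<sigma> i =
     fps_const (Kgen \<sigma> i) * (Abs_fps (\<lambda>k. cst (1 / fact k)) oo h_series q M \<sigma> i)"

definition phi :: "complex \<Rightarrow> nat \<Rightarrow> pm \<Rightarrow> nat \<Rightarrow> int \<Rightarrow> free" where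
  "phi q M \<sigma> i n = (if sg \<sigma> * n \<ge> 0 then fps_nth (phi_series q M \<sigma> i) (nat (sg \<sigma> * n)) else 0)"

inductive relation :: "complex \<Rightarrow> nat \<Rightarrow> nat \<Rightarrow> free \<Rightarrow> free \<Rightarrow> bool" for q M N where
  K_inv_right: "i \<in> {1..<M + N} \<Longrightarrow> relation q M N (Kgen Pos i * Kgen Neg i) 1"
| K_inv_left: "i \<in> {1..<M + N} \<Longrightarrow> relation q M N (Kgen Neg i * Kgen Pos i) 1"
| K_K: "\<lbrakk>i \<in> {1..<M + N}; j \<in> {1..<M + N}\<rbrakk> \<Longrightarrow> relation q M N (br M 1 (Kgen Pos i) (Kgen Pos j)) 0"
| K_h: "\<lbrakk>i \<in> {1..<M + N}; j \<in> {1..<M + N}; s \<noteq> 0\<rbrakk> \<Longrightarrow>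
    relation q M N (br M 1 (Kgen Pos i) (hgen j s)) 0"
| h_h: "\<lbrakk>i \<in> {1..<M + N}; j \<in> {1..<M + N}; s \<noteq> 0; t \<noteq> 0\<rbrakk> \<Longrightarrow>
    relation q M N (br M 1 (hgen i s) (hgen j t)) 0"
| K_X: "\<lbrakk>i \<in> {1..<M + N}; j \<in> {1..<M + N}\<rbrakk> \<Longrightarrow>
    relation q M N (Kgen Pos i * Xgen \<sigma> j n * Kgen Neg i) (cst (q powi (sg \<sigma> * cform M i j)) * Xgen \<sigma> j n)"
| h_X: "\<lbrakk>i \<in> {1..<M + N}; j \<in> {1..<M + N}; s \<noteq> 0\<rbrakk> \<Longrightarrow>
    relation q M N (br M 1 (hgen i s) (Xgen \<sigma> j n))
      (cst (of_int (sg \<sigma>) * qint (qi q M i) (s * ell M i * cform M i j) / of_int s) * Xgen \<sigma> j (n + s))"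
| X_X_cartan: "\<lbrakk>i \<in> {1..<M + N}; j \<in> {1..<M + N}\<rbrakk> \<Longrightarrow>
    relation q M N (br M 1 (Xgen Pos i m) (Xgen Neg j n))
      (if i = j
       then cst (1 / (qi q M i - inverse (qi q M i))) * (phi q M Pos i (m + n) - phi q M Neg i (m + n))
       else 0)"
| X_X_orthogonal: "\<lbrakk>i \<in> {1..<M + N}; j \<in> {1..<M + N}; cform M i j = 0\<rbrakk> \<Longrightarrow>
    relation q M N (br M 1 (Xgen \<sigma> i m) (Xgen \<sigma> j n)) 0"
| X_X_quadratic: "\<lbrakk>i \<in> {1..<M + N}; j \<in> {1..<M + N}; cform M i j \<noteq> 0\<rbrakk> \<Longrightarrow>
    relation q M N
      (Xgen \<sigma> i (m + 1) * Xgen \<sigma> j n - cst (q powi (sg \<sigma> * cform M i j)) * (Xgen \<sigma> j n * Xgen \<sigma> i (m + 1)))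
      (cst (q powi (sg \<sigma> * cform M i j)) * (Xgen \<sigma> i m * Xgen \<sigma> j (n + 1)) - Xgen \<sigma> j (n + 1) * Xgen \<sigma> i m)"
| X_Serre: "\<lbrakk>i \<in> {1..<M + N}; j \<in> {1..<M + N}; cform M i j = 1 \<or> cform M i j = -1; i \<noteq> M\<rbrakk> \<Longrightarrow>
    relation q M N
      (br M q (Xgen \<sigma> i m) (br M (inverse q) (Xgen \<sigma> i n) (Xgen \<sigma> j k)) +
       br M q (Xgen \<sigma> i n) (br M (inverse q) (Xgen \<sigma> i m) (Xgen \<sigma> j k))) 0"
| X_super_Serre: "\<lbrakk>M > 1; N > 1\<rbrakk> \<Longrightarrow>
    relation q M N
      (br M 1 (br M q (br M (inverse q) (Xgen \<sigma> (M - 1) m) (Xgen \<sigma> M n)) (Xgen \<sigma> (M + 1) k)) (Xgen \<sigma> M u) +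
       br M 1 (br M q (br M (inverse q) (Xgen \<sigma> (M - 1) m) (Xgen \<sigma> M u)) (Xgen \<sigma> (M + 1) k)) (Xgen \<sigma> M n)) 0"


section \<open>The quantum loop superalgebra\<close>

definition rel_ideal :: "complex \<Rightarrow> nat \<Rightarrow> nat \<Rightarrow> free set" where
  "rel_ideal q M N = Idl\<^bsub>free_algebra M N\<^esub> {a - b | a b. relation q M N a b}"

abbreviation U_ring :: "complex \<Rightarrow> nat \<Rightarrow> nat \<Rightarrow> free set ring" where
  "U_ring q M N \<equiv> free_algebra M N Quot rel_ideal q M N"

definition proj :: "complex \<Rightarrow> nat \<Rightarrow> nat \<Rightarrow> free \<Rightarrow> free set" where
  "proj q M N a = rel_ideal q M N +>\<^bsub>free_algebra M N\<^esub> a"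

definition Uq :: "complex \<Rightarrow> nat \<Rightarrow> nat \<Rightarrow> (complex, free set) module" where
  "Uq q M N = ring.extend (U_ring q M N)
     (module.fields (\<lambda>a x. proj q M N (cst a) \<otimes>\<^bsub>U_ring q M N\<^esub> x))"

abbreviation complex_field :: "complex ring" where
  "complex_field \<equiv> ring_of_type_algebra"

definition span_of :: "(complex, 'a, 'm) module_scheme \<Rightarrow> 'a set \<Rightarrow> 'a set" where
  "span_of A S = (\<lambda>H. submodule H complex_field A) hull S"

definition subalgebra_of :: "(complex, 'a, 'm) module_scheme \<Rightarrow> 'a set \<Rightarrow> 'a set" where
  "subalgebra_of A S = (\<lambda>H. submodule H complex_field A \<and> subring H A) hull S"

definition U_plus :: "complex \<Rightarrow> nat \<Rightarrow> nat \<Rightarrow> free set set" where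
  "U_plus q M N = subalgebra_of (Uq q M N) {proj q M N (Xgen Pos i n) | i n. i \<in> {1..<M + N}}"


section \<open>Root vectors and ordered products\<close>

text \<open>A root $\alpha_i+\cdots+\alpha_j$ is encoded as the pair \<open>(i, j)\<close>; the total order on
  roots is then the lexicographic order of \<^theory>\<open>HOL-Library.Product_Lexorder\<close>.\<close>

definition roots :: "nat \<Rightarrow> nat \<Rightarrow> (nat \<times> nat) set" where
  "roots M N = {(i, j). 1 \<le> i \<and> i \<le> j \<and> j < M + N}"

text \<open>The brackets are formed in the free superalgebra: the relations are homogeneous for the
  parity, so \<^const>\<open>proj\<close> carries them to the brackets of the quotient.\<close>

definition root_vector :: "complex \<Rightarrow> nat \<Rightarrow> nat \<Rightarrow> nat \<times> nat \<Rightarrow> int \<Rightarrow> free set" where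
  "root_vector q M N = (\<lambda>(i, j) n. proj q M N
     (foldl (\<lambda>a k. br M (qi q M k) a (Xgen Pos k 0)) (Xgen Pos i n) [i + 1..<j + 1]))"

definition list_product :: "('a, 'm) monoid_scheme \<Rightarrow> 'a list \<Rightarrow> 'a" where
  "list_product G xs = foldr (\<otimes>\<^bsub>G\<^esub>) xs \<one>\<^bsub>G\<^esub>"

text \<open>\<open>m \<beta>\<close> is the multiplicity $c_\beta$ and \<open>n i \<beta>\<close> is $n_{i,\beta}$.\<close>

definition ordered_product ::
  "complex \<Rightarrow> nat \<Rightarrow> nat \<Rightarrow> (nat \<times> nat \<Rightarrow> nat) \<Rightarrow> (nat \<Rightarrow> nat \<times> nat \<Rightarrow> int) \<Rightarrow> free set" where
  "ordered_product q M N m n = list_product (Uq q M N)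
     (map (\<lambda>\<beta>. list_product (Uq q M N) (map (\<lambda>i. root_vector q M N \<beta> (n i \<beta>)) [1..<m \<beta> + 1]))
       (sorted_list_of_set (roots M N)))"

end

theory Submission
  imports Defs
begin

text \<open>Work modulo the ideal \<open>J\<close> of relations. Fix \<open>k\<close>, let \<open>U\<close> be the subalgebra generated by the
  $X^+_{i,n}$ with $i > k$, and write $y_j(m)$ for the root vectors of $\alpha_k+\dots+\alpha_j$ and
  $F_j = \sum_{a \le j} y_a U$. The quadratic and (super) Serre relations give two facts:

  (1) $X_{i,n} F_j \subseteq F_j$ for $i \ne j+1$, and $X_{j+1,n} F_j \subseteq F_{j+1}$. Hence $V = \sum_j y_j U$ is
  a left $U$-module, so that all root vectors $y_j$ can be moved to the left of $U$.

  (2) $y_j y_{j'} \in \sum_{a < j} y_a V$ for $j' < j$. As the first index drops strictly, words in the $y$'s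
  can be sorted from the left.

  In both cases the quadratic relations shift the loop indices of two adjacent nodes against each
  other, which reduces the critical words to words with two equal loop indices, and those are
  controlled by a single Serre relation, lifted from a generator to a root vector. Downward
  induction on \<open>k\<close> concludes.\<close>

section \<open>Algebras modulo an ideal\<close>

text \<open>A symmetrised Serre relation at loop indices a, b controls only the sum of two critical
  words. For a = b the sum is twice one word, and characteristic zero permits halving it; this is
  why equal indices are sought. Indices can be shifted because a quadratic relation contains either
  order of the two adjacent letters at two index pairs with the same sum: once all words of one
  order lie in a right module, membership of the other order depends on the index sum alone. Every
  letter appended to a root vector has index 0, and this is the index to be matched. The argument
  asks only that certain scalars be nonzero, so the scalars stay abstract. That q is not a root of
  unity provides q + q^{-1} \<noteq> 0, the coefficient of the middle Serre term. Signs nearly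
  vanish: a root vector contains the odd node \<open>M\<close> at most once, so each bracket that
  builds it has an even factor; anticommutators arise only from two letters of node \<open>M\<close>
  and in the outermost super Serre bracket. Calculations use representatives in the free algebra, a
  type with ring operations, and equality means difference in \<open>J\<close>.\<close>

locale algebra_mod_ideal =
  fixes sc :: "'f::field_char_0 \<Rightarrow> 'a::ring_1 \<Rightarrow> 'a" and J :: "'a set"
  assumes sc_add: "sc c (x + y) = sc c x + sc c y"
    and sc_add_left: "sc (c + d) x = sc c x + sc d x"
    and sc_sc: "sc c (sc d x) = sc (c * d) x"
    and sc_one: "sc 1 x = x"
    and mult_sc_left: "sc c x * y = sc c (x * y)"
    and mult_sc_right: "x * sc c y = sc c (x * y)"
    and J_zero: "0 \<in> J"
    and J_add: "x \<in> J \<Longrightarrow> y \<in> J \<Longrightarrow> x + y \<in> J"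
    and J_left: "x \<in> J \<Longrightarrow> z * x \<in> J"
    and J_right: "x \<in> J \<Longrightarrow> x * z \<in> J"
begin

lemma sc_minus: "sc c (- x) = - sc c x"
  using mult_sc_left[of c 1 "- x"] mult_sc_left[of c 1 x] by simp

lemma sc_diff: "sc c (x - y) = sc c x - sc c y"
  by (metis sc_add sc_minus diff_conv_add_uminus)

lemma sc_zero_left: "sc 0 x = 0"
  using sc_add_left[of 0 0 x] by simp

lemma sc_neg: "sc (-1) x = - x"
  using sc_add_left[of 1 "-1" x] by (simp add: sc_zero_left sc_one eq_neg_iff_add_eq_0 add.commute)

lemma sc_two: "sc 2 x = x + x"
  using sc_add_left[of 1 1 x] by (simp add: sc_one)

lemmas sc_simps = sc_add sc_minus sc_diff sc_sc mult_sc_left mult_sc_right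

lemma J_sc: "x \<in> J \<Longrightarrow> sc c x \<in> J"
  by (metis J_left mult_sc_left mult_1)

lemma J_minus: "x \<in> J \<Longrightarrow> - x \<in> J"
  by (metis J_sc sc_neg)

lemma J_diff: "x \<in> J \<Longrightarrow> y \<in> J \<Longrightarrow> x - y \<in> J"
  by (metis J_add J_minus diff_conv_add_uminus)

text \<open>Including \<open>J\<close> makes membership independent of the representative. Right
  factors are single letters, so inductions peel off one letter at a time. For \<open>Y = {}\<close>
  this is the linear span modulo \<open>J\<close>.\<close>

inductive_set rspan :: "'a set \<Rightarrow> 'a set \<Rightarrow> 'a set" for Y G where
  J: "x \<in> J \<Longrightarrow> x \<in> rspan Y G"
| gen: "x \<in> G \<Longrightarrow> x \<in> rspan Y G"
| add: "x \<in> rspan Y G \<Longrightarrow> y \<in> rspan Y G \<Longrightarrow> x + y \<in> rspan Y G"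
| sc: "x \<in> rspan Y G \<Longrightarrow> sc c x \<in> rspan Y G"
| right: "x \<in> rspan Y G \<Longrightarrow> y \<in> Y \<Longrightarrow> x * y \<in> rspan Y G"

lemma rspan_minus: "x \<in> rspan Y G \<Longrightarrow> - x \<in> rspan Y G"
  by (metis rspan.sc sc_neg)

lemma rspan_diff: "x \<in> rspan Y G \<Longrightarrow> y \<in> rspan Y G \<Longrightarrow> x - y \<in> rspan Y G"
  by (metis rspan.add rspan_minus diff_conv_add_uminus)

lemma rspan_zero: "0 \<in> rspan Y G"
  by (simp add: J_zero rspan.J)

lemma rspan_unscale: "sc c x \<in> rspan Y G \<Longrightarrow> c \<noteq> 0 \<Longrightarrow> x \<in> rspan Y G"
  by (metis rspan.sc sc_sc sc_one left_inverse)

lemma rspan_double: "x + x \<in> rspan Y G \<Longrightarrow> x \<in> rspan Y G"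
  by (metis rspan_unscale sc_two zero_neq_numeral)

lemma rspan_cong: "x \<in> rspan Y G \<Longrightarrow> z - x \<in> J \<Longrightarrow> z \<in> rspan Y G"
  by (metis rspan.J rspan.add diff_add_cancel)

lemma rspan_subset:
  assumes "x \<in> rspan Y G" and "\<And>g. g \<in> G \<Longrightarrow> g \<in> rspan Y G'"
  shows "x \<in> rspan Y G'"
  using assms(1) by induct (blast intro: rspan.intros assms(2))+

text \<open>Left multiplication commutes with the right action, so the generators decide. This
  reduces statements about whole right modules to statements about root vectors.\<close>

lemma rspan_mult_left:
  assumes "x \<in> rspan Y G" and "\<And>g. g \<in> G \<Longrightarrow> z * g \<in> rspan Y G'"
  shows "z * x \<in> rspan Y G'"
  using assms(1)
proof induct
  case (J x)
  then show ?case by (simp add: J_left rspan.J)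
next
  case (gen x)
  then show ?case by (rule assms(2))
next
  case (add x y)
  then show ?case by (simp add: distrib_left rspan.add)
next
  case (sc x c)
  then show ?case by (simp add: mult_sc_right rspan.sc)
next
  case (right x y)
  then show ?case by (metis rspan.right mult.assoc)
qed

section \<open>Commutation modulo the ideal and lifting along brackets\<close>

definition commuting :: "'a \<Rightarrow> 'a \<Rightarrow> bool" where
  "commuting a b \<longleftrightarrow> a * b - b * a \<in> J"

lemma commuting_sym: "commuting a b \<Longrightarrow> commuting b a"
  unfolding commuting_def by (metis J_minus minus_diff_eq)

lemma commuting_mult:
  assumes "commuting a b" "commuting a c"
  shows "commuting a (b * c)"
proof -
  have "a * (b * c) - b * c * a = (a * b - b * a) * c + b * (a * c - c * a)"
    by (simp add: algebra_simps)
  then show ?thesis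
    using assms unfolding commuting_def by (metis J_add J_left J_right)
qed

lemma commuting_diff_sc:
  assumes "commuting a b" "commuting a c"
  shows "commuting a (b - sc k c)"
proof -
  have "a * (b - sc k c) - (b - sc k c) * a = (a * b - b * a) - sc k (a * c - c * a)"
    by (simp add: algebra_simps sc_simps)
  then show ?thesis
    using assms unfolding commuting_def by (metis J_diff J_sc)
qed

text \<open>The context \<open>u\<close>, \<open>w\<close> lets a commutation act in the middle of a
  right-nested word.\<close>

lemma rspan_swap:
  assumes "commuting a b" and "u * (b * (a * w)) \<in> rspan Y G"
  shows "u * (a * (b * w)) \<in> rspan Y G"
proof (rule rspan_cong[OF assms(2)])
  have "u * (a * (b * w)) - u * (b * (a * w)) = u * ((a * b - b * a) * w)"
    by (simp add: algebra_simps)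
  then show "u * (a * (b * w)) - u * (b * (a * w)) \<in> J"
    using assms(1) unfolding commuting_def by (metis J_left J_right)
qed

lemma rspan_swap0:
  assumes "commuting a b" and "b * (a * w) \<in> rspan Y G"
  shows "a * (b * w) \<in> rspan Y G"
  using rspan_swap[OF assms(1), of 1] assms(2) by simp

lemma rspan_swap_end:
  assumes "commuting a b" and "u * (b * a) \<in> rspan Y G"
  shows "u * (a * b) \<in> rspan Y G"
  using rspan_swap[OF assms(1), of u 1] assms(2) by simp

text \<open>Maps that commute, modulo \<open>J\<close>, with the bracket \<open>Y \<mapsto> [x, Y]\<^sub>k\<close>: a relation
  \<open>f Y \<in> J\<close> given by such a map lifts from \<open>Y\<close> to \<open>[x, Y]\<^sub>k\<close>.\<close>

definition liftable :: "'f \<Rightarrow> 'a \<Rightarrow> ('a \<Rightarrow> 'a) \<Rightarrow> bool" where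
  "liftable k x f \<longleftrightarrow> (\<forall>Y. f (x * Y - sc k (Y * x)) - (x * f Y - sc k (f Y * x)) \<in> J)"

lemma liftable_id: "liftable k x (\<lambda>Y. Y)"
  by (simp add: liftable_def J_zero)

lemma liftable_left:
  assumes "commuting x a" and "liftable k x f"
  shows "liftable k x (\<lambda>Y. a * f Y)"
  unfolding liftable_def
proof
  fix Y
  have "a * f (x * Y - sc k (Y * x)) - (x * (a * f Y) - sc k (a * f Y * x)) =
      a * (f (x * Y - sc k (Y * x)) - (x * f Y - sc k (f Y * x))) - (x * a - a * x) * f Y"
    by (simp add: algebra_simps sc_simps)
  also have "\<dots> \<in> J"
    using assms unfolding commuting_def liftable_def by (blast intro: J_diff J_left J_right)
  finally show "a * f (x * Y - sc k (Y * x)) - (x * (a * f Y) - sc k (a * f Y * x)) \<in> J" .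
qed

lemma liftable_right:
  assumes "commuting x a" and "liftable k x f"
  shows "liftable k x (\<lambda>Y. f Y * a)"
  unfolding liftable_def
proof
  fix Y
  have "f (x * Y - sc k (Y * x)) * a - (x * (f Y * a) - sc k (f Y * a * x)) =
      (f (x * Y - sc k (Y * x)) - (x * f Y - sc k (f Y * x))) * a - sc k (f Y * (x * a - a * x))"
    by (simp add: algebra_simps sc_simps)
  also have "\<dots> \<in> J"
    using assms unfolding commuting_def liftable_def by (blast intro: J_diff J_sc J_left J_right)
  finally show "f (x * Y - sc k (Y * x)) * a - (x * (f Y * a) - sc k (f Y * a * x)) \<in> J" .
qed

lemma liftable_add:
  assumes "liftable k x f" and "liftable k x g"
  shows "liftable k x (\<lambda>Y. f Y + g Y)"
  unfolding liftable_def
proof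
  fix Y
  let ?Z = "x * Y - sc k (Y * x)"
  have "f ?Z + g ?Z - (x * (f Y + g Y) - sc k ((f Y + g Y) * x)) =
      (f ?Z - (x * f Y - sc k (f Y * x))) + (g ?Z - (x * g Y - sc k (g Y * x)))"
    by (simp add: algebra_simps sc_simps)
  also have "\<dots> \<in> J"
    using assms unfolding liftable_def by (blast intro: J_add)
  finally show "f ?Z + g ?Z - (x * (f Y + g Y) - sc k ((f Y + g Y) * x)) \<in> J" .
qed

lemma liftable_sc:
  assumes "liftable k x f"
  shows "liftable k x (\<lambda>Y. sc d (f Y))"
  unfolding liftable_def
proof
  fix Y
  let ?Z = "x * Y - sc k (Y * x)"
  have "sc d (f ?Z) - (x * sc d (f Y) - sc k (sc d (f Y) * x)) =
      sc d (f ?Z - (x * f Y - sc k (f Y * x)))"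
    by (simp add: algebra_simps sc_simps)
  also have "\<dots> \<in> J"
    using assms unfolding liftable_def by (blast intro: J_sc)
  finally show "sc d (f ?Z) - (x * sc d (f Y) - sc k (sc d (f Y) * x)) \<in> J" .
qed

lemma liftable_diff:
  assumes "liftable k x f" and "liftable k x g"
  shows "liftable k x (\<lambda>Y. f Y - g Y)"
  using liftable_add[OF assms(1) liftable_sc[OF assms(2), of "-1"]] by (simp add: sc_neg)

lemmas liftable_intros =
  liftable_id liftable_left liftable_right liftable_add liftable_diff liftable_sc

lemma liftable_mem:
  assumes "liftable k x f" and "f Y \<in> J"
  shows "f (x * Y - sc k (Y * x)) \<in> J"
proof -
  have "f (x * Y - sc k (Y * x)) - (x * f Y - sc k (f Y * x)) \<in> J"
    using assms(1) by (simp add: liftable_def)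
  moreover have "x * f Y - sc k (f Y * x) \<in> J"
    by (intro J_diff J_sc J_left J_right assms(2))
  ultimately show ?thesis by (metis J_add diff_add_cancel)
qed

text \<open>For t = q + q^{-1} this is the expansion of [a,[b,Y]_{q^{-1}}]_q + [b,[a,Y]_{q^{-1}}]_q
  with even a, b. Linearity in \<open>Y\<close> is what makes it liftable.\<close>

definition serre :: "'f \<Rightarrow> 'a \<Rightarrow> 'a \<Rightarrow> 'a \<Rightarrow> 'a" where
  "serre t a b Y = a * (b * Y) + b * (a * Y) - sc t (a * (Y * b) + b * (Y * a))
     + (Y * a * b + Y * b * a)"

text \<open>One summand of the super Serre relation when its two odd loop indices coincide. The
  element w = [[Y,a]_u,b]_v is odd like \<open>a\<close>, hence the plus sign in the last bracket.
  The expression is linear in \<open>Y\<close>, though not in \<open>a\<close>.\<close>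

definition super_serre :: "'f \<Rightarrow> 'f \<Rightarrow> 'a \<Rightarrow> 'a \<Rightarrow> 'a \<Rightarrow> 'a" where
  "super_serre u v a b Y =
     (let z = Y * a - sc u (a * Y); w = z * b - sc v (b * z) in w * a + a * w)"

lemma serre_lift:
  assumes "commuting x a" "commuting x b" "serre t a b Y \<in> J"
  shows "serre t a b (x * Y - sc k (Y * x)) \<in> J"
proof -
  have "liftable k x (serre t a b)"
    unfolding serre_def by (intro liftable_intros assms)
  then show ?thesis using liftable_mem assms(3) by blast
qed

lemma super_serre_lift:
  assumes "commuting x a" "commuting x b" "super_serre u v a b Y \<in> J"
  shows "super_serre u v a b (x * Y - sc k (Y * x)) \<in> J"
proof -
  have "liftable k x (super_serre u v a b)"
    unfolding super_serre_def Let_def by (intro liftable_intros assms)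
  then show ?thesis using liftable_mem assms(3) by blast
qed

text \<open>Two of the eight words serve as unknowns later, both with coefficient
  \<open>u * v\<close>: \<open>a * (b * (a * x))\<close> for one root vector and
  \<open>b * (a * (x * a))\<close> for a pair.\<close>

lemma super_serre_expand:
  "super_serre u v a b x =
     x * (a * (b * a)) - sc u (a * (x * (b * a))) - sc v (b * (x * (a * a))) + sc (u * v) (b * (a * (x * a)))
     + a * (x * (a * b)) - sc u (a * (a * (x * b))) - sc v (a * (b * (x * a))) + sc (u * v) (a * (b * (a * x)))"
  unfolding super_serre_def Let_def by (simp add: algebra_simps sc_simps)

end

section \<open>Root vectors with a fixed first node\<close>

text \<open>The nodes are relabelled so that the first one is \<open>0\<close> and the last one is \<open>D\<close>; \<open>y d m\<close> is the
  root vector of the nodes \<open>0, \<dots>, d\<close>.\<close>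

locale row = algebra_mod_ideal sc J
  for sc :: "'f::field_char_0 \<Rightarrow> 'a::ring_1 \<Rightarrow> 'a" and J :: "'a set" +
  fixes A :: "nat \<Rightarrow> int \<Rightarrow> 'a" and D :: nat and odd_at :: "nat \<Rightarrow> bool"
    and k p :: "nat \<Rightarrow> 'f" and t u v :: 'f
  assumes k_nonzero: "k i \<noteq> 0" and p_nonzero: "p i \<noteq> 0" and t_nonzero: "t \<noteq> 0"
    and u_nonzero: "u \<noteq> 0" and v_nonzero: "v \<noteq> 0"
    and A_commuting: "i + 2 \<le> j \<Longrightarrow> j \<le> D \<Longrightarrow> commuting (A i m) (A j n)"
    and A_quadratic: "i < D \<Longrightarrow>
      (A i (m + 1) * A (i + 1) n - sc (p i) (A (i + 1) n * A i (m + 1)))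
        - (sc (p i) (A i m * A (i + 1) (n + 1)) - A (i + 1) (n + 1) * A i m) \<in> J"
    and A_odd: "i \<le> D \<Longrightarrow> odd_at i \<Longrightarrow> A i m * A i n + A i n * A i m \<in> J"
    and A_serre: "i \<le> D \<Longrightarrow> j \<le> D \<Longrightarrow> i = j + 1 \<or> j = i + 1 \<Longrightarrow> \<not> odd_at i \<Longrightarrow>
      serre t (A i m) (A i n) (A j l) \<in> J"
    and A_super_serre: "1 \<le> i \<Longrightarrow> i < D \<Longrightarrow> odd_at i \<Longrightarrow>
      super_serre u v (A i n) (A (i + 1) l) (A (i - 1) m) \<in> J"
begin

primrec y :: "nat \<Rightarrow> int \<Rightarrow> 'a" where
  "y 0 m = A 0 m"
| "y (Suc d) m = y d m * A (Suc d) 0 - sc (k (Suc d)) (A (Suc d) 0 * y d m)"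

lemma y_Suc: "y (Suc d) m = y d m * A (Suc d) 0 - sc (k (Suc d)) (A (Suc d) 0 * y d m)"
  by simp

declare y.simps(2) [simp del]

definition tail :: "'a set" where
  "tail = {A i n | i n. 1 \<le> i \<and> i \<le> D}"

definition F :: "nat \<Rightarrow> 'a set" where
  "F d = rspan tail {y a m | a m. a \<le> d}"

lemma tail_mem: "1 \<le> i \<Longrightarrow> i \<le> D \<Longrightarrow> A i n \<in> tail"
  by (auto simp: tail_def)

section \<open>Relations between generators and root vectors\<close>

lemma y_commuting: "d + 2 \<le> i \<Longrightarrow> i \<le> D \<Longrightarrow> commuting (A i n) (y d m)"
proof (induct d)
  case 0
  then show ?case by (simp add: A_commuting commuting_sym)
next
  case (Suc d)
  then have "commuting (A i n) (y d m)" "commuting (A i n) (A (Suc d) 0)"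
    by (simp_all add: A_commuting commuting_sym)
  then show ?case by (simp add: y_Suc commuting_diff_sc commuting_mult)
qed

text \<open>The last bracket of \<open>y (i - 1)\<close> joins \<open>y (i - 2)\<close>, which
  commutes with node i, to a letter of node i - 1. The Serre relation of these adjacent nodes
  therefore lifts along that bracket.\<close>

lemma y_serre:
  assumes "1 \<le> i" "i \<le> D" "\<not> odd_at i"
  shows "serre t (A i m) (A i n) (y (i - 1) l) \<in> J"
proof (cases "i = 1")
  case True
  then show ?thesis using A_serre[of i 0] assms by simp
next
  case False
  then obtain j where i: "i = Suc (Suc j)" using assms(1) by (metis Suc_pred' One_nat_def Suc_le_eq not0_implies_Suc)
  have "commuting (y j l) (A i n)" for n
    using assms i by (intro commuting_sym[OF y_commuting]) auto
  then show ?thesis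
    using serre_lift A_serre[of i "Suc j" m n 0] assms i by (simp add: y_Suc)
qed

text \<open>As for the Serre relation: \<open>y (i - 2)\<close> commutes with node i + 1 as
  well.\<close>

lemma y_super_serre:
  assumes "1 \<le> i" "i < D" "odd_at i"
  shows "super_serre u v (A i n) (A (i + 1) l) (y (i - 1) m) \<in> J"
proof (cases "i = 1")
  case True
  then show ?thesis using A_super_serre[of i] assms by simp
next
  case False
  then obtain j where i: "i = Suc (Suc j)" using assms(1) by (metis Suc_pred' One_nat_def Suc_le_eq not0_implies_Suc)
  have "commuting (y j m) (A i n)" "commuting (y j m) (A (i + 1) l)" for n l
    using assms i by (auto intro: commuting_sym[OF y_commuting])
  then show ?thesis
    using super_serre_lift A_super_serre[of i n l 0] assms i by (simp add: y_Suc)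
qed

section \<open>Shifting loop indices between adjacent nodes\<close>

lemma int_pair_transport:
  fixes P :: "int \<Rightarrow> int \<Rightarrow> bool"
  assumes step: "\<And>n m. P (n + 1) m \<longleftrightarrow> P n (m + 1)" and "P n m" and "n + m = n' + m'"
  shows "P n' m'"
proof -
  have *: "P (n + int j) (m - int j) \<longleftrightarrow> P n m" for j n m
  proof (induct j arbitrary: n m)
    case (Suc j)
    then show ?case using step[of "n + int j" "m - int j - 1"] by (simp add: algebra_simps)
  qed simp
  show ?thesis
  proof (cases "n \<le> n'")
    case True
    then show ?thesis using *[of n "nat (n' - n)" m] assms(2,3) by (simp add: algebra_simps)
  next
    case False
    moreover have "m' - (n - n') = m" using assms(3) by simp
    ultimately show ?thesis using *[of n' "nat (n - n')" m'] assms(2) by simp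
  qed
qed

lemma quadratic_mult:
  assumes "i < D"
  shows "A i (m + 1) * (A (i + 1) n * w) - sc (p i) (A (i + 1) n * (A i (m + 1) * w))
      - sc (p i) (A i m * (A (i + 1) (n + 1) * w)) + A (i + 1) (n + 1) * (A i m * w) \<in> J"
  using J_right[OF A_quadratic[OF assms, of m n], of w] by (simp add: algebra_simps sc_simps)

text \<open>Modulo the right module the two words with node i in front drop out of the quadratic
  relation. What remains makes the two words with node i + 1 in front proportional, with the nonzero
  factor \<open>p i\<close>.\<close>

lemma shift_upper:
  assumes i: "i < D" and *: "\<And>a b. A i a * (A (i + 1) b * w) \<in> rspan Y G"
    and "A (i + 1) n * (A i m * w) \<in> rspan Y G" and "n + m = n' + m'"
  shows "A (i + 1) n' * (A i m' * w) \<in> rspan Y G"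
proof (rule int_pair_transport[where P = "\<lambda>n m. A (i + 1) n * (A i m * w) \<in> rspan Y G", OF _ assms(3,4)])
  fix n m
  let ?q = "A i (m + 1) * (A (i + 1) n * w) - sc (p i) (A (i + 1) n * (A i (m + 1) * w))
      - sc (p i) (A i m * (A (i + 1) (n + 1) * w)) + A (i + 1) (n + 1) * (A i m * w)"
  let ?z = "A i (m + 1) * (A (i + 1) n * w) - sc (p i) (A i m * (A (i + 1) (n + 1) * w))"
  have q: "?q \<in> rspan Y G" by (rule rspan.J[OF quadratic_mult[OF i]])
  have z: "?z \<in> rspan Y G" by (intro rspan_diff rspan.sc *)
  show "A (i + 1) (n + 1) * (A i m * w) \<in> rspan Y G \<longleftrightarrow> A (i + 1) n * (A i (m + 1) * w) \<in> rspan Y G"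
  proof
    assume a: "A (i + 1) (n + 1) * (A i m * w) \<in> rspan Y G"
    have "sc (p i) (A (i + 1) n * (A i (m + 1) * w)) = ?z + A (i + 1) (n + 1) * (A i m * w) - ?q"
      by simp
    also have "\<dots> \<in> rspan Y G" by (intro rspan_diff rspan.add q z a)
    finally show "A (i + 1) n * (A i (m + 1) * w) \<in> rspan Y G"
      using rspan_unscale p_nonzero by blast
  next
    assume a: "A (i + 1) n * (A i (m + 1) * w) \<in> rspan Y G"
    have "A (i + 1) (n + 1) * (A i m * w) = ?q - ?z + sc (p i) (A (i + 1) n * (A i (m + 1) * w))"
      by simp
    also have "\<dots> \<in> rspan Y G" by (intro rspan_diff rspan.add rspan.sc q z a)
    finally show "A (i + 1) (n + 1) * (A i m * w) \<in> rspan Y G" .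
  qed
qed

lemma shift_lower:
  assumes i: "i < D" and *: "\<And>a b. A (i + 1) b * (A i a * w) \<in> rspan Y G"
    and "A i m * (A (i + 1) n * w) \<in> rspan Y G" and "m + n = m' + n'"
  shows "A i m' * (A (i + 1) n' * w) \<in> rspan Y G"
proof (rule int_pair_transport[where P = "\<lambda>m n. A i m * (A (i + 1) n * w) \<in> rspan Y G", OF _ assms(3,4)])
  fix m n
  let ?q = "A i (m + 1) * (A (i + 1) n * w) - sc (p i) (A (i + 1) n * (A i (m + 1) * w))
      - sc (p i) (A i m * (A (i + 1) (n + 1) * w)) + A (i + 1) (n + 1) * (A i m * w)"
  let ?z = "A (i + 1) (n + 1) * (A i m * w) - sc (p i) (A (i + 1) n * (A i (m + 1) * w))"
  have q: "?q \<in> rspan Y G" by (rule rspan.J[OF quadratic_mult[OF i]])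
  have z: "?z \<in> rspan Y G" by (intro rspan_diff rspan.sc *)
  show "A i (m + 1) * (A (i + 1) n * w) \<in> rspan Y G \<longleftrightarrow> A i m * (A (i + 1) (n + 1) * w) \<in> rspan Y G"
  proof
    assume a: "A i (m + 1) * (A (i + 1) n * w) \<in> rspan Y G"
    have "sc (p i) (A i m * (A (i + 1) (n + 1) * w)) = ?z + A i (m + 1) * (A (i + 1) n * w) - ?q"
      by simp
    also have "\<dots> \<in> rspan Y G" by (intro rspan_diff rspan.add q z a)
    finally show "A i m * (A (i + 1) (n + 1) * w) \<in> rspan Y G"
      using rspan_unscale p_nonzero by blast
  next
    assume a: "A i m * (A (i + 1) (n + 1) * w) \<in> rspan Y G"
    have "A i (m + 1) * (A (i + 1) n * w) = ?q - ?z + sc (p i) (A i m * (A (i + 1) (n + 1) * w))"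
      by simp
    also have "\<dots> \<in> rspan Y G" by (intro rspan_diff rspan.add rspan.sc q z a)
    finally show "A i (m + 1) * (A (i + 1) n * w) \<in> rspan Y G" .
  qed
qed

section \<open>Left multiplication by generators on the modules \<open>F\<close>\<close>

lemma F_y: "a \<le> d \<Longrightarrow> y a m \<in> F d"
  unfolding F_def by (rule rspan.gen) blast

lemma F_right: "x \<in> F d \<Longrightarrow> 1 \<le> i \<Longrightarrow> i \<le> D \<Longrightarrow> x * A i n \<in> F d"
  unfolding F_def by (rule rspan.right) (auto simp: tail_mem)

lemma F_mono: "x \<in> F d \<Longrightarrow> d \<le> e \<Longrightarrow> x \<in> F e"
  unfolding F_def by (erule rspan_subset) (auto intro!: rspan.gen)

lemma F_mult_left: "x \<in> F d \<Longrightarrow> (\<And>a m. a \<le> d \<Longrightarrow> z * y a m \<in> F e) \<Longrightarrow> z * x \<in> F e"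
  unfolding F_def by (erule rspan_mult_left) auto

lemma F_y_right: "a \<le> d \<Longrightarrow> 1 \<le> i \<Longrightarrow> i \<le> D \<Longrightarrow> y a m * A i n \<in> F d"
  by (simp add: F_y F_right)

lemma far_left_y:
  assumes "d + 2 \<le> i" "i \<le> D" "d \<le> e"
  shows "A i n * y d m \<in> F e"
  using rspan_swap0[OF y_commuting[OF assms(1,2), of n m], of 1 tail] F_y_right[of d e i] assms
  by (simp add: F_def)

lemma far_left: "x \<in> F d \<Longrightarrow> d + 2 \<le> i \<Longrightarrow> i \<le> D \<Longrightarrow> A i n * x \<in> F d"
  by (erule F_mult_left) (simp add: far_left_y)

text \<open>At loop index 0 the definition of \<open>y (Suc d)\<close> can be solved for the swapped
  product.\<close>

lemma next_left_zero:
  assumes "d < D"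
  shows "A (Suc d) 0 * y d m \<in> F (Suc d)"
proof -
  have "sc (k (Suc d)) (A (Suc d) 0 * y d m) = y d m * A (Suc d) 0 - y (Suc d) m"
    by (simp add: y_Suc)
  also have "\<dots> \<in> F (Suc d)"
    using F_y_right[of d "Suc d" "Suc d"] F_y[of "Suc d" "Suc d"] assms
    unfolding F_def by (intro rspan_diff) auto
  finally show ?thesis
    unfolding F_def by (rule rspan_unscale) (rule k_nonzero)
qed

text \<open>The definition of a root vector handles only index 0 of the new letter. The index
  \<open>n\<close> is therefore shifted onto node d, where the induction hypothesis (for d = 0 the
  root vector itself) admits every index, and the front letter is left with index 0.\<close>

lemma next_left_y: "d < D \<Longrightarrow> A (Suc d) n * y d m \<in> F (Suc d)"
proof (induct d arbitrary: n m)
  case 0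
  have "A (0 + 1) n * (A 0 m * 1) \<in> rspan tail {y a m | a m. a \<le> 1}"
  proof (rule shift_upper[OF 0])
    show "A 0 a * (A (0 + 1) b * 1) \<in> rspan tail {y a m | a m. a \<le> 1}" for a b
      using F_y_right[of 0 1 1 a b] 0 by (simp add: F_def)
    show "A (0 + 1) 0 * (A 0 (n + m) * 1) \<in> rspan tail {y a m | a m. a \<le> 1}"
      using next_left_zero[of 0 "n + m"] 0 by (simp add: F_def)
  qed simp
  then show ?case by (simp add: F_def)
next
  case (Suc d)
  let ?x = "y d m" and ?F = "F (Suc (Suc d))"
  have c: "commuting (A (Suc d + 1) b) ?x" for b using Suc by (intro y_commuting) auto
  have lower: "A (Suc d) a * ?x \<in> F (Suc d)" for a using Suc by simp
  have zero_left: "A (Suc (Suc d)) 0 * f \<in> ?F" if "f \<in> F (Suc d)" for f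
  proof (rule F_mult_left[OF that])
    fix a m assume "a \<le> Suc d"
    then show "A (Suc (Suc d)) 0 * y a m \<in> ?F"
      using next_left_zero[of "Suc d"] far_left_y[of a "Suc (Suc d)"] Suc(2)
      by (cases "a = Suc d") auto
  qed
  have "A (Suc d + 1) n * (A (Suc d) 0 * ?x) \<in> rspan tail {y a m | a m. a \<le> Suc (Suc d)}"
  proof (rule shift_upper[OF Suc(2)])
    show "A (Suc d) a * (A (Suc d + 1) b * ?x) \<in> rspan tail {y a m | a m. a \<le> Suc (Suc d)}" for a b
    proof (rule rspan_swap_end[OF c])
      have "A (Suc d) a * ?x * A (Suc (Suc d)) b \<in> F (Suc d)"
        using Suc(2) by (intro F_right lower) auto
      then have "A (Suc d) a * ?x * A (Suc (Suc d)) b \<in> F (Suc (Suc d))" by (rule F_mono) simp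
      then show "A (Suc d) a * (?x * A (Suc d + 1) b) \<in> rspan tail {y a m | a m. a \<le> Suc (Suc d)}"
        by (simp add: F_def mult.assoc)
    qed
    show "A (Suc d + 1) 0 * (A (Suc d) n * ?x) \<in> rspan tail {y a m | a m. a \<le> Suc (Suc d)}"
      using zero_left[OF lower[of n]] by (simp add: F_def)
  qed simp
  then have "A (Suc (Suc d)) n * (A (Suc d) 0 * ?x) \<in> ?F" by (simp add: F_def)
  moreover have "A (Suc (Suc d)) n * (?x * A (Suc d) 0) \<in> ?F"
    using F_right[OF F_y_right[of d "Suc (Suc d)" "Suc (Suc d)" m n], of "Suc d" 0] Suc(2)
      rspan_swap0[OF c[of n]] by (simp add: F_def mult.assoc)
  ultimately show ?case
    unfolding F_def by (simp add: y_Suc right_diff_distrib mult_sc_right rspan_diff rspan.sc)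
qed

lemma next_left:
  assumes "x \<in> F d" "d < D"
  shows "A (Suc d) n * x \<in> F (Suc d)"
proof (rule F_mult_left[OF assms(1)])
  fix a m assume "a \<le> d"
  then show "A (Suc d) n * y a m \<in> F (Suc d)"
    using next_left_y far_left_y[of a "Suc d"] assms(2) by (cases "a = d") auto
qed

text \<open>Node i commutes with \<open>y a\<close> for a + 2 \<le> i, and for a + 1 = i the result
  lies in \<open>F i\<close>, inside \<open>F d\<close>. The cases a \<ge> i are left as a
  hypothesis because they become available in turn, beginning with a = i.\<close>

lemma left_of_stay:
  assumes "\<And>a m. i \<le> a \<Longrightarrow> a \<le> d \<Longrightarrow> A i n * y a m \<in> F a" and "1 \<le> i" "i \<le> d" "d \<le> D" "x \<in> F d"
  shows "A i n * x \<in> F d"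
proof (rule F_mult_left[OF assms(5)])
  fix a m assume a: "a \<le> d"
  consider "i \<le> a" | "Suc a = i" | "a + 2 \<le> i" by linarith
  then show "A i n * y a m \<in> F d"
    using assms a next_left_y[of a n m] far_left_y[of a i d n m] F_mono[of _ _ d]
    by cases auto
qed

text \<open>For odd i this is anticommutation. For even i it is the lifted Serre relation, all of
  whose other words end in a letter of node i, hence in a letter of \<open>tail\<close>.\<close>

lemma stay_square:
  assumes "1 \<le> i" "i \<le> D"
  shows "A i m * (A i n * y (i - 1) l) + A i n * (A i m * y (i - 1) l) \<in> F i"
proof (cases "odd_at i")
  case True
  have "A i m * (A i n * y (i - 1) l) + A i n * (A i m * y (i - 1) l) \<in> J"
    using J_right[OF A_odd[OF assms(2) True, of m n], of "y (i - 1) l"] by (simp add: algebra_simps)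
  then show ?thesis unfolding F_def by (rule rspan.J)
next
  case False
  let ?x = "y (i - 1) l"
  have s: "serre t (A i m) (A i n) ?x \<in> F i"
    unfolding F_def by (rule rspan.J, rule y_serre) fact+
  have "A i n * ?x \<in> F i" for n
    using next_left_y[of "i - 1"] assms by simp
  then have 1: "A i m * (?x * A i n) \<in> F i" for m n
    using F_right[of "A i m * ?x" i i n] assms by (simp add: mult.assoc)
  have 2: "?x * A i m * A i n \<in> F i" for m n
    using assms by (intro F_right F_y_right) auto
  have "A i m * (A i n * ?x) + A i n * (A i m * ?x) =
      serre t (A i m) (A i n) ?x + sc t (A i m * (?x * A i n) + A i n * (?x * A i m))
        - (?x * A i m * A i n + ?x * A i n * A i m)"
    by (simp add: serre_def)
  also have "\<dots> \<in> F i"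
    using s 1 2 unfolding F_def by (intro rspan_diff rspan.add rspan.sc)
  finally show ?thesis .
qed

text \<open>The square relation determines only symmetric sums, so index 0 is treated separately:
  there the sum is a double. Then \<open>A i 0\<close> preserves \<open>F i\<close>, which disposes
  of one summand of the mixed sum with indices n and 0.\<close>

lemma stay_top:
  assumes "1 \<le> i" "i \<le> D"
  shows "A i n * y i m \<in> F i"
proof -
  obtain j where i: "i = Suc j" using assms(1) by (cases i) auto
  have expand: "A i n * y i m \<in> F i" if "A i n * (A i 0 * y j m) \<in> F i" for n m
  proof -
    have "A i n * (y j m * A i 0) \<in> F i"
      using F_right[OF next_left_y[of j n m], of i 0] assms i by (simp add: mult.assoc)
    with that show ?thesis
      unfolding F_def i by (simp add: y_Suc right_diff_distrib mult_sc_right rspan_diff rspan.sc)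
  qed
  have "A i 0 * (A i 0 * y j m) \<in> F i" for m
    using stay_square[OF assms, of 0 0 m] i unfolding F_def by - (rule rspan_double, simp)
  then have zero: "A i 0 * y i m \<in> F i" for m by (rule expand)
  have "A i 0 * f \<in> F i" if "f \<in> F i" for f
  proof (rule left_of_stay[OF _ assms(1) order_refl assms(2) that])
    fix a m assume "i \<le> a" "a \<le> i"
    then show "A i 0 * y a m \<in> F a" using zero by simp
  qed
  moreover have "A i n * y j m \<in> F i"
    using next_left_y[of j n m] assms i by simp
  ultimately have "A i 0 * (A i n * y j m) \<in> F i" by blast
  moreover have "A i n * (A i 0 * y j m) + A i 0 * (A i n * y j m) \<in> F i"
    using stay_square[OF assms, of n 0 m] i by simp
  ultimately have "A i n * (A i 0 * y j m) + A i 0 * (A i n * y j m) - A i 0 * (A i n * y j m) \<in> F i"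
    unfolding F_def by (intro rspan_diff)
  then have "A i n * (A i 0 * y j m) \<in> F i" by simp
  then show ?thesis by (rule expand)
qed

lemma top_left:
  assumes "x \<in> F i" "1 \<le> i" "i \<le> D"
  shows "A i n * x \<in> F i"
proof (rule left_of_stay[OF _ assms(2) order_refl assms(3,1)])
  fix a m assume "i \<le> a" "a \<le> i"
  then show "A i n * y a m \<in> F a" using stay_top assms(2,3) by simp
qed

text \<open>As the outer letters have the same index, one relation isolates the word. At an even
  node it is the middle term, with coefficient 2t, of the Serre relation of nodes i and i + 1. At an
  odd node it is the last word of the lifted super Serre relation.\<close>

lemma stay_sandwich:
  assumes "1 \<le> i" "i < D"
  shows "A i s * (A (i + 1) l * (A i s * y (i - 1) m)) \<in> F (i + 1)"
proof -
  let ?x = "y (i - 1) m" and ?B = "A (i + 1) l" and ?A = "A i s"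
  let ?G = "{y a m | a m. a \<le> i + 1}"
  have c: "commuting ?B ?x" using assms by (intro y_commuting) auto
  have Ax: "?A * ?x \<in> F i" using next_left_y[of "i - 1"] assms by simp
  have AAx: "?A * (?A * ?x) \<in> F i" using top_left[OF Ax] assms by simp
  have BAAx: "?B * (?A * (?A * ?x)) \<in> F (i + 1)" using next_left[OF AAx] assms by simp
  have "?A * (?A * (?x * ?B)) \<in> F i"
    using F_right[OF AAx, of "i + 1" l] assms by (simp add: mult.assoc)
  then have AAxB: "?A * (?A * (?x * ?B)) \<in> F (i + 1)" by (rule F_mono) simp
  have AABx: "?A * (?A * (?B * ?x)) \<in> F (i + 1)"
    using AAxB rspan_swap_end[OF c, of "?A * ?A" tail ?G] by (simp add: F_def mult.assoc)
  show ?thesis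
  proof (cases "odd_at i")
    case False
    let ?S = "serre t ?A ?A ?B * ?x"
    have S: "?S \<in> F (i + 1)"
      unfolding F_def by (rule rspan.J, rule J_right, rule A_serre) (use assms False in auto)
    let ?T = "?A * (?B * (?A * ?x))"
    have "sc t (?T + ?T) = ?A * (?A * (?B * ?x)) + ?A * (?A * (?B * ?x))
        + (?B * (?A * (?A * ?x)) + ?B * (?A * (?A * ?x))) - ?S"
      unfolding serre_def by (simp add: algebra_simps sc_simps)
    also have "\<dots> \<in> F (i + 1)"
      using S AABx BAAx unfolding F_def by (intro rspan_diff rspan.add)
    finally show ?thesis
      unfolding F_def by (rule rspan_double[OF rspan_unscale[OF _ t_nonzero]])
  next
    case True
    have S: "super_serre u v ?A ?B ?x \<in> F (i + 1)"
      unfolding F_def by (rule rspan.J, rule y_super_serre) (use assms True in auto)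
    have rA: "f * ?A \<in> F (i + 1)" and rB: "f * ?B \<in> F (i + 1)" if "f \<in> F (i + 1)" for f
      using F_right[OF that] assms by simp_all
    have x: "?x \<in> F (i + 1)" using F_y by simp
    have Ax': "?A * ?x \<in> F (i + 1)" using F_mono[OF Ax] by simp
    have 1: "?x * (?A * (?B * ?A)) \<in> F (i + 1)"
      using rA[OF rB[OF rA[OF x]]] by (simp add: mult.assoc)
    have 2: "?A * (?x * (?B * ?A)) \<in> F (i + 1)" using rA[OF rB[OF Ax']] by (simp add: mult.assoc)
    have "?x * (?B * (?A * ?A)) \<in> F (i + 1)" using rA[OF rA[OF rB[OF x]]] by (simp add: mult.assoc)
    then have 3: "?B * (?x * (?A * ?A)) \<in> F (i + 1)"
      using rspan_swap0[OF c] by (simp add: F_def)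
    have "?B * (?A * ?x) \<in> F (i + 1)" using next_left[OF Ax] assms by simp
    then have 4: "?B * (?A * (?x * ?A)) \<in> F (i + 1)" using rA[of "?B * (?A * ?x)"] by (simp add: mult.assoc)
    have 5: "?A * (?x * (?A * ?B)) \<in> F (i + 1)" using rB[OF rA[OF Ax']] by (simp add: mult.assoc)
    have 6: "?A * (?B * (?x * ?A)) \<in> F (i + 1)"
      using 2 rspan_swap[OF c] by (simp add: F_def)
    have "sc (u * v) (?A * (?B * (?A * ?x))) = super_serre u v ?A ?B ?x -
       (?x * (?A * (?B * ?A)) - sc u (?A * (?x * (?B * ?A))) - sc v (?B * (?x * (?A * ?A)))
       + sc (u * v) (?B * (?A * (?x * ?A)))
       + ?A * (?x * (?A * ?B)) - sc u (?A * (?A * (?x * ?B))) - sc v (?A * (?B * (?x * ?A))))"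
      unfolding super_serre_expand by simp
    also have "\<dots> \<in> F (i + 1)"
      using S 1 2 3 4 5 6 AAxB unfolding F_def by (intro rspan_diff rspan.add rspan.sc)
    finally show ?thesis
      unfolding F_def by (rule rspan_unscale) (simp add: u_nonzero v_nonzero)
  qed
qed

text \<open>The critical word has letters A_i(n), A_{i+1}(0), A_i(0) before
  \<open>y (i - 1)\<close>. Shifting n onto the middle letter gives both outer letters the index 0,
  the sandwich case.\<close>

lemma stay_next:
  assumes "1 \<le> i" "i < D"
  shows "A i n * y (i + 1) m \<in> F (i + 1)"
proof -
  obtain j where i: "i = Suc j" using assms(1) by (cases i) auto
  let ?x = "y j m" and ?G = "{y a m | a m. a \<le> i + 1}"
  have c: "commuting (A (i + 1) 0) ?x" using assms i by (intro y_commuting) auto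
  have Ax: "A i a * ?x \<in> F i" for a using next_left_y[of j] assms i by simp
  have "A i n * (A (i + 1) 0 * (A i 0 * ?x)) \<in> rspan tail ?G"
  proof (rule shift_lower[OF assms(2)])
    show "A (i + 1) b * (A i a * (A i 0 * ?x)) \<in> rspan tail ?G" for a b
      using next_left[OF top_left[OF Ax]] assms by (simp add: F_def)
    show "A i 0 * (A (i + 1) n * (A i 0 * ?x)) \<in> rspan tail ?G"
      using stay_sandwich[OF assms, of 0 n m] i by (simp add: F_def)
  qed simp
  then have 1: "A i n * (A (i + 1) 0 * (A i 0 * ?x)) \<in> F (i + 1)" by (simp add: F_def)
  have "A i n * ?x * A (i + 1) 0 * A i 0 \<in> F i"
    using assms by (intro F_right Ax) auto
  then have "A i n * ?x * A (i + 1) 0 * A i 0 \<in> F (i + 1)" by (rule F_mono) simp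
  then have 2: "A i n * (A (i + 1) 0 * (?x * A i 0)) \<in> F (i + 1)"
    using rspan_swap[OF c] by (simp add: F_def mult.assoc)
  have 3: "A i n * (A (i + 1) 0 * y i m) \<in> F (i + 1)"
    using 1 2 unfolding F_def i
    by (simp add: y_Suc right_diff_distrib mult_sc_right rspan_diff rspan.sc)
  have "A i n * y i m * A (i + 1) 0 \<in> F i" using stay_top assms by (intro F_right) auto
  then have "A i n * y i m * A (i + 1) 0 \<in> F (i + 1)" by (rule F_mono) simp
  with 3 show ?thesis unfolding F_def
    by (simp add: y_Suc right_diff_distrib mult_sc_right rspan_diff rspan.sc mult.assoc)
qed

text \<open>Beyond node i + 1 the appended letter commutes with \<open>A i n\<close>, so the
  property is inherited; d = i and d = i + 1 are the genuine cases.\<close>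

lemma stay: "1 \<le> i \<Longrightarrow> i \<le> d \<Longrightarrow> d \<le> D \<Longrightarrow> A i n * y d m \<in> F d"
proof (induct d)
  case (Suc d)
  consider "i = Suc d" | "i = d" | "i < d" using Suc by linarith
  then show ?case
  proof cases
    case 3
    have c: "commuting (A i n) (A (Suc d) 0)" using 3 Suc by (intro A_commuting) auto
    have IH: "A i n * y d m \<in> F d" using 3 Suc by simp
    have "A i n * y d m * A (Suc d) 0 \<in> F d" using Suc by (intro F_right IH) auto
    then have "A i n * y d m * A (Suc d) 0 \<in> F (Suc d)" by (rule F_mono) simp
    moreover have "A (Suc d) 0 * (A i n * y d m) \<in> F (Suc d)"
      using next_left[OF IH] Suc by simp
    then have "A i n * (A (Suc d) 0 * y d m) \<in> F (Suc d)"
      using rspan_swap0[OF c] by (simp add: F_def)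
    ultimately show ?thesis
      unfolding F_def by (simp add: y_Suc right_diff_distrib mult_sc_right rspan_diff rspan.sc mult.assoc)
  qed (use Suc stay_top stay_next[of d] in auto)
qed simp

lemma F_left:
  assumes "x \<in> F d" "1 \<le> i" "i \<le> D" "d \<le> D" "i \<noteq> d + 1"
  shows "A i n * x \<in> F d"
proof (cases "i \<le> d")
  case True
  then show ?thesis using left_of_stay[OF _ _ _ _ assms(1)] stay assms by auto
next
  case False
  then show ?thesis using far_left assms by auto
qed

section \<open>Products of two root vectors and the modules \<open>H\<close>\<close>

definition H :: "nat \<Rightarrow> 'a set" where
  "H d = rspan tail {y a m * v | a m v. a \<le> d \<and> v \<in> F D}"

lemma H_gen: "a \<le> d \<Longrightarrow> x \<in> F D \<Longrightarrow> y a m * x \<in> H d"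
  unfolding H_def by (rule rspan.gen) blast

lemma H_right: "x \<in> H d \<Longrightarrow> 1 \<le> i \<Longrightarrow> i \<le> D \<Longrightarrow> x * A i n \<in> H d"
  unfolding H_def by (rule rspan.right) (auto simp: tail_mem)

lemma H_mono: "x \<in> H d \<Longrightarrow> d \<le> e \<Longrightarrow> x \<in> H e"
  unfolding H_def by (erule rspan_subset) (blast intro: rspan.gen le_trans)

lemma tail_left: "1 \<le> i \<Longrightarrow> i \<le> D \<Longrightarrow> x \<in> F D \<Longrightarrow> A i n * x \<in> F D"
  using F_left by simp

text \<open>The tail letters of \<open>x\<close> are absorbed by \<open>z\<close>, since
  \<open>F D\<close> is stable under left multiplication by them.\<close>

lemma F_mult_F:
  assumes "x \<in> F d" "z \<in> F D"
  shows "x * z \<in> H d"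
  using assms unfolding F_def[of d]
proof (induct arbitrary: z)
  case (J x)
  then show ?case unfolding H_def by (intro rspan.J J_right)
next
  case (gen x)
  then show ?case using H_gen by blast
next
  case (add x x')
  then show ?case unfolding H_def by (simp add: distrib_right rspan.add)
next
  case (sc x c)
  then show ?case unfolding H_def by (simp add: mult_sc_left rspan.sc)
next
  case (right x w)
  then show ?case by (auto simp: tail_def mult.assoc tail_left)
qed

lemma H_mult_left:
  assumes "x \<in> H d" and "\<And>a m. a \<le> d \<Longrightarrow> z * y a m \<in> F e"
  shows "z * x \<in> H e"
  using assms(1) unfolding H_def[of d]
proof (induct)
  case (J x)
  then show ?case unfolding H_def by (intro rspan.J J_left)
next
  case (gen x)
  then show ?case using F_mult_F[OF assms(2)] by (auto simp flip: mult.assoc)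
next
  case (add x x')
  then show ?case unfolding H_def by (simp add: distrib_left rspan.add)
next
  case (sc x c)
  then show ?case unfolding H_def by (simp add: mult_sc_right rspan.sc)
next
  case (right x w)
  then show ?case unfolding tail_def using H_right by (auto simp flip: mult.assoc)
qed

lemma H_left: "x \<in> H d \<Longrightarrow> 1 \<le> i \<Longrightarrow> i \<le> D \<Longrightarrow> d \<le> D \<Longrightarrow> i \<noteq> d + 1 \<Longrightarrow> A i n * x \<in> H d"
  by (erule H_mult_left) (auto intro: F_left F_y)

lemma H_next: "x \<in> H d \<Longrightarrow> d < D \<Longrightarrow> A (Suc d) n * x \<in> H (Suc d)"
  by (erule H_mult_left) (auto intro: next_left F_y)

lemma y_left_H: "a \<le> d \<Longrightarrow> x \<in> F D \<Longrightarrow> y a m * x \<in> H d"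
  by (rule F_mult_F) (simp_all add: F_y)

text \<open>Node 1 takes a single \<open>y 0\<close> only into \<open>F 1\<close>; in front of two
  of them the first index stays 0. At equal indices the square of an odd letter is in
  \<open>J\<close>, and for an even node the Serre relation rewrites A_1 A_0 A_0 through words that
  begin with A_0.\<close>

lemma top_pair:
  assumes "1 \<le> D"
  shows "A 1 l * (y 0 m * y 0 n) \<in> H 0"
proof -
  let ?G = "{y a m * v | a m v. a \<le> 0 \<and> v \<in> F D}"
  have one_left: "A 1 b * A 0 m \<in> F D" for b m
    using F_mono[OF next_left_y[of 0 b m]] assms by simp
  have 0: "A 0 a * z \<in> H 0" if "z \<in> F D" for a z
    using y_left_H[of 0 0 z a] that by simp
  have "A 1 l * (A 0 s * A 0 s) \<in> H 0" for l s
  proof (cases "odd_at 0")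
    case True
    have "A 1 l * (A 0 s * A 0 s + A 0 s * A 0 s) \<in> H 0"
      unfolding H_def by (rule rspan.J, rule J_left, rule A_odd) (use True in auto)
    then show ?thesis
      unfolding H_def distrib_left by (rule rspan_double)
  next
    case False
    let ?S = "serre t (A 0 s) (A 0 s) (A 1 l)"
    have S: "?S \<in> H 0"
      unfolding H_def by (rule rspan.J, rule A_serre) (use assms False in auto)
    have "A 0 s * A 1 l \<in> F D" using F_y_right[of 0 D 1 s l] assms by simp
    then have 1: "A 0 s * (A 0 s * A 1 l) \<in> H 0" by (rule 0)
    have 2: "A 0 s * (A 1 l * A 0 s) \<in> H 0" by (rule 0[OF one_left])
    have "A 1 l * (A 0 s * A 0 s) + A 1 l * (A 0 s * A 0 s) =
       ?S - (A 0 s * (A 0 s * A 1 l) + A 0 s * (A 0 s * A 1 l))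
        + sc t (A 0 s * (A 1 l * A 0 s) + A 0 s * (A 1 l * A 0 s))"
      by (simp add: serre_def mult.assoc)
    also have "\<dots> \<in> H 0"
      using S 1 2 unfolding H_def by (intro rspan_diff rspan.add rspan.sc)
    finally show ?thesis
      unfolding H_def by (rule rspan_double)
  qed
  then have *: "A 1 l * (A 0 s * A 0 s) \<in> H 0" for l s .
  have "A (0 + 1) l * (A 0 m * A 0 n) \<in> rspan tail ?G"
  proof (rule shift_upper)
    show "A 0 a * (A (0 + 1) b * A 0 n) \<in> rspan tail ?G" for a b
      using 0[OF one_left] by (simp add: H_def)
    \<comment> \<open>Node 0 receives index \<open>n\<close>, to agree with its second letter, and
      node 1 takes the rest of the sum \<open>l + m\<close>.\<close>
    show "A (0 + 1) (l + m - n) * (A 0 n * A 0 n) \<in> rspan tail ?G"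
      using * by (simp add: H_def)
  qed (use assms in auto)
  then show ?thesis by (simp add: H_def)
qed

text \<open>At an even node two Serre relations cooperate. The lifted one trades the target for B A
  A x x' and B x A A x'; the one between A and B then moves B behind a letter A, where the
  hypothesis on A x x' applies. At an odd node the super Serre relation times x' contains the target
  directly.\<close>

lemma sandwich_pair:
  assumes i: "1 \<le> i" "i < D"
    and IH: "\<And>n. A i n * (y (i - 1) m * y (i - 1) m') \<in> H (i - 1)"
  shows "A (i + 1) l * (A i s * (y (i - 1) m * (A i s * y (i - 1) m'))) \<in> H i"
proof -
  let ?x = "y (i - 1) m" and ?x' = "y (i - 1) m'" and ?B = "A (i + 1) l" and ?A = "A i s"
  have c: "commuting ?B ?x" and c': "commuting ?B ?x'" using i by (auto intro!: y_commuting)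
  have V: "A j n * z \<in> F D" if "z \<in> F D" "j = i \<or> j = i + 1" for z j n
    using tail_left[OF _ _ that(1)] that(2) i by auto
  have x'V: "?x' \<in> F D" using F_y i by simp
  have Ax: "?A * ?x \<in> F i" using next_left_y[of "i - 1"] i by simp
  have x_H: "?x * z \<in> H i" if "z \<in> F D" for z using y_left_H that by simp
  have Ax_H: "?A * (?x * z) \<in> H i" if "z \<in> F D" for z
    using F_mult_F[OF Ax that] by (simp add: mult.assoc)
  have AAx_H: "?A * (?A * (?x * z)) \<in> H i" if "z \<in> F D" for z
    using F_mult_F[OF top_left[OF Ax] that] i by (simp add: mult.assoc)
  have A_H: "?A * z \<in> H i" if "z \<in> H (i - 1)" for z
    using H_next[OF that] i by simp
  have B_H: "?B * z \<in> H (i - 1)" if "z \<in> H (i - 1)" for z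
    using H_left[OF that] i by simp
  have BAxx': "?B * (?A * (?x * ?x')) \<in> H (i - 1)" by (rule B_H[OF IH])
  have ABAxx': "?A * (?B * (?A * (?x * ?x'))) \<in> H i" by (rule A_H[OF BAxx'])
  have "?x * (?B * (?A * (?A * ?x'))) \<in> H i" by (intro x_H V x'V) auto
  then have BxAAx': "?B * (?x * (?A * (?A * ?x'))) \<in> H i"
    using rspan_swap0[OF c] by (simp add: H_def)
  show ?thesis
  proof (cases "odd_at i")
    case False
    have S1: "?B * (serre t ?A ?A ?x * ?x') \<in> H i"
      unfolding H_def by (intro rspan.J J_left J_right y_serre) (use i False in auto)
    have S2: "serre t ?A ?A ?B * (?x * ?x') \<in> H i"
      unfolding H_def by (rule rspan.J, rule J_right, rule A_serre) (use i False in auto)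
    \<comment> \<open>\<open>B\<close> commutes with both root vectors, so it may be carried to the
      right end, where it is a letter of \<open>tail\<close>.\<close>
    have "?A * (?x * ?x') * ?B \<in> H (i - 1)" using i by (intro H_right[OF IH]) auto
    then have "?A * (?A * (?x * ?x') * ?B) \<in> H i" by (rule A_H)
    then have "?A * (?A * (?x * (?x' * ?B))) \<in> H i" by (simp add: mult.assoc)
    then have "?A * (?A * (?x * (?B * ?x'))) \<in> H i"
      using rspan_swap_end[OF c', of "?A * (?A * ?x)"] by (simp add: H_def mult.assoc)
    then have AABxx': "?A * (?A * (?B * (?x * ?x'))) \<in> H i"
      using rspan_swap[OF c, of "?A * ?A"] by (simp add: H_def mult.assoc)
    let ?P = "?B * (?A * (?A * (?x * ?x')))" and ?T = "?B * (?A * (?x * (?A * ?x')))"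
    have "?P + ?P = serre t ?A ?A ?B * (?x * ?x')
        - (?A * (?A * (?B * (?x * ?x'))) + ?A * (?A * (?B * (?x * ?x'))))
        + sc t (?A * (?B * (?A * (?x * ?x'))) + ?A * (?B * (?A * (?x * ?x'))))"
      unfolding serre_def by (simp add: algebra_simps sc_simps)
    also have "\<dots> \<in> H i"
      using S2 AABxx' ABAxx' unfolding H_def by (intro rspan_diff rspan.add rspan.sc)
    finally have PP: "?P + ?P \<in> H i" .
    have "sc t (?T + ?T) = ?P + ?P
        + (?B * (?x * (?A * (?A * ?x'))) + ?B * (?x * (?A * (?A * ?x')))) - ?B * (serre t ?A ?A ?x * ?x')"
      unfolding serre_def by (simp add: algebra_simps sc_simps)
    also have "\<dots> \<in> H i"
      using rspan_diff[OF rspan.add[OF PP[unfolded H_def] rspan.add[OF BxAAx'[unfolded H_def] BxAAx'[unfolded H_def]]]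
          S1[unfolded H_def]]
      unfolding H_def .
    finally show ?thesis
      unfolding H_def by (rule rspan_double[OF rspan_unscale[OF _ t_nonzero]])
  next
    case True
    have S: "super_serre u v ?A ?B ?x * ?x' \<in> H i"
      unfolding H_def by (rule rspan.J, rule J_right, rule y_super_serre) (use i True in auto)
    have 1: "?x * (?A * (?B * (?A * ?x'))) \<in> H i" by (intro x_H V x'V) auto
    have 2: "?A * (?x * (?B * (?A * ?x'))) \<in> H i" by (intro Ax_H V x'V) auto
    have 3: "?A * (?x * (?A * (?B * ?x'))) \<in> H i" by (intro Ax_H V x'V) auto
    have 4: "?A * (?A * (?x * (?B * ?x'))) \<in> H i" by (intro AAx_H V x'V) auto
    have 5: "?A * (?B * (?x * (?A * ?x'))) \<in> H i"
      using 2 rspan_swap[OF c] by (simp add: H_def)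
    have "sc (u * v) (?B * (?A * (?x * (?A * ?x')))) = super_serre u v ?A ?B ?x * ?x' -
       (?x * (?A * (?B * (?A * ?x'))) - sc u (?A * (?x * (?B * (?A * ?x'))))
        - sc v (?B * (?x * (?A * (?A * ?x'))))
       + ?A * (?x * (?A * (?B * ?x'))) - sc u (?A * (?A * (?x * (?B * ?x'))))
       - sc v (?A * (?B * (?x * (?A * ?x')))) + sc (u * v) (?A * (?B * (?A * (?x * ?x')))))"
      unfolding super_serre_expand by (simp add: algebra_simps sc_simps)
    also have "\<dots> \<in> H i"
      using S 1 2 3 4 5 BxAAx' ABAxx' unfolding H_def by (intro rspan_diff rspan.add rspan.sc)
    finally show ?thesis
      unfolding H_def by (rule rspan_unscale) (simp add: u_nonzero v_nonzero)
  qed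
qed

text \<open>Both root vectors end in a bracket with the same letter of index 0, so in the induction
  step the critical word has equal indices from the start.\<close>

lemma next_left_pair: "d < D \<Longrightarrow> A (Suc d) l * (y d m * y d m') \<in> H d"
proof (induct d arbitrary: l m m')
  case 0
  then show ?case using top_pair by simp
next
  case (Suc d)
  let ?x = "y d m" and ?x' = "y d m'" and ?B = "A (Suc (Suc d)) l" and ?A = "A (Suc d) 0"
  have c: "commuting ?B ?x" using Suc(2) by (intro y_commuting) auto
  have V: "y (Suc d) m' \<in> F D" using F_y Suc(2) by simp
  have IH: "A (Suc d) n * (?x * ?x') \<in> H d" for n using Suc by simp
  have "?x * (?B * (?A * y (Suc d) m')) \<in> H (Suc d)"
    using Suc(2) by (intro y_left_H tail_left V) auto
  then have 1: "?B * (?x * (?A * y (Suc d) m')) \<in> H (Suc d)"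
    using rspan_swap0[OF c] by (simp add: H_def)
  have "?B * (?A * (?x * ?x')) * ?A \<in> H d" using Suc(2) by (intro H_right H_left IH) auto
  then have "?B * (?A * (?x * ?x')) * ?A \<in> H (Suc d)" by (rule H_mono) simp
  then have 2: "?B * (?A * (?x * (?x' * ?A))) \<in> H (Suc d)" by (simp add: mult.assoc)
  have 3: "?B * (?A * (?x * (?A * ?x'))) \<in> H (Suc d)"
    using sandwich_pair[of "Suc d" m m' l 0] IH Suc(2) by simp
  have "?B * (y (Suc d) m * y (Suc d) m') = ?B * (?x * (?A * y (Suc d) m'))
      - sc (k (Suc d)) (?B * (?A * (?x * (?x' * ?A)))
        - sc (k (Suc d)) (?B * (?A * (?x * (?A * ?x')))))"
    by (simp add: y_Suc algebra_simps sc_simps)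
  also have "\<dots> \<in> H (Suc d)"
    using 1 2 3 unfolding H_def by (intro rspan_diff rspan.sc)
  finally show ?case .
qed

text \<open>The last letter of the left factor is split off. Standing in the middle, it leaves a
  word that starts with a lower root vector. Standing in front, it meets either an equal pair,
  treated above, or a product whose first index is already below d and which node d + 1 cannot
  raise.\<close>

lemma y_pair_straighten: "d \<le> D \<Longrightarrow> e < d \<Longrightarrow> y d m * y e m' \<in> H (d - 1)"
proof (induct d)
  case (Suc d)
  have V: "y e m' \<in> F D" using F_y Suc by simp
  have "y d m * (A (Suc d) 0 * y e m') \<in> H d"
    using Suc by (intro y_left_H tail_left V) auto
  moreover have "A (Suc d) 0 * (y d m * y e m') \<in> H d"
  proof (cases "e = d")
    case True
    then show ?thesis using next_left_pair Suc by simp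
  next
    case False
    then have IH: "y d m * y e m' \<in> H (d - 1)" using Suc by simp
    have "A (Suc d) 0 * (y d m * y e m') \<in> H (d - 1)" using Suc False by (intro H_left[OF IH]) auto
    then show ?thesis by (rule H_mono) simp
  qed
  moreover have "y (Suc d) m * y e m' = y d m * (A (Suc d) 0 * y e m')
      - sc (k (Suc d)) (A (Suc d) 0 * (y d m * y e m'))"
    by (simp add: y_Suc algebra_simps sc_simps)
  ultimately show ?case unfolding H_def by (simp add: rspan_diff rspan.sc)
qed simp

section \<open>Sorting words in root vectors of one row\<close>

primrec T :: "nat \<Rightarrow> 'a set" where
  "T 0 = rspan tail {1}"
| "T (Suc r) = rspan tail {y a m * z | a m z. a \<le> D \<and> z \<in> T r}"

primrec ordT :: "nat \<Rightarrow> nat \<Rightarrow> 'a set" where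
  "ordT 0 a = rspan tail {1}"
| "ordT (Suc r) a = rspan tail {y b m * z | b m z. a \<le> b \<and> b \<le> D \<and> z \<in> ordT r b}"

lemma T_rspan: "\<exists>G. T r = rspan tail G"
  by (cases r) auto

lemma ordT_rspan: "\<exists>G. ordT r a = rspan tail G"
  by (cases r) auto

lemma T_closed:
  "x \<in> J \<Longrightarrow> x \<in> T r" "x \<in> T r \<Longrightarrow> z \<in> T r \<Longrightarrow> x + z \<in> T r"
  "x \<in> T r \<Longrightarrow> sc c x \<in> T r" "x \<in> T r \<Longrightarrow> 1 \<le> i \<Longrightarrow> i \<le> D \<Longrightarrow> x * A i n \<in> T r"
proof -
  obtain G where "T r = rspan tail G" using T_rspan by blast
  then show "x \<in> J \<Longrightarrow> x \<in> T r" "x \<in> T r \<Longrightarrow> z \<in> T r \<Longrightarrow> x + z \<in> T r"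
    "x \<in> T r \<Longrightarrow> sc c x \<in> T r" "x \<in> T r \<Longrightarrow> 1 \<le> i \<Longrightarrow> i \<le> D \<Longrightarrow> x * A i n \<in> T r"
    by (simp_all add: rspan.J rspan.add rspan.sc rspan.right tail_mem)
qed

lemma ordT_closed:
  "x \<in> J \<Longrightarrow> x \<in> ordT r a" "x \<in> ordT r a \<Longrightarrow> z \<in> ordT r a \<Longrightarrow> x + z \<in> ordT r a"
  "x \<in> ordT r a \<Longrightarrow> sc c x \<in> ordT r a" "x \<in> ordT r a \<Longrightarrow> 1 \<le> i \<Longrightarrow> i \<le> D \<Longrightarrow> x * A i n \<in> ordT r a"
proof -
  obtain G where "ordT r a = rspan tail G" using ordT_rspan by blast
  then show "x \<in> J \<Longrightarrow> x \<in> ordT r a" "x \<in> ordT r a \<Longrightarrow> z \<in> ordT r a \<Longrightarrow> x + z \<in> ordT r a"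
    "x \<in> ordT r a \<Longrightarrow> sc c x \<in> ordT r a" "x \<in> ordT r a \<Longrightarrow> 1 \<le> i \<Longrightarrow> i \<le> D \<Longrightarrow> x * A i n \<in> ordT r a"
    by (simp_all add: rspan.J rspan.add rspan.sc rspan.right tail_mem)
qed

lemma T_y_left: "x \<in> T r \<Longrightarrow> a \<le> D \<Longrightarrow> y a m * x \<in> T (Suc r)"
  by (auto intro!: rspan.gen)

lemma ordT_y_left: "x \<in> ordT r b \<Longrightarrow> a \<le> b \<Longrightarrow> b \<le> D \<Longrightarrow> y b m * x \<in> ordT (Suc r) a"
  by (auto intro!: rspan.gen)

lemma T_zero_left:
  assumes "x \<in> T 0" "1 \<le> i" "i \<le> D"
  shows "A i n * x \<in> T 0"
  using assms(1) unfolding T.simps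
proof (rule rspan_mult_left)
  fix g :: 'a assume "g \<in> {1}"
  then have "A i n * g = 1 * A i n" by simp
  also have "\<dots> \<in> rspan tail {1}"
    using assms by (intro rspan.right rspan.gen tail_mem) auto
  finally show "A i n * g \<in> rspan tail {1}" .
qed

text \<open>Left stability is a hypothesis because the two facts alternate: stability at length r +
  1 uses this product rule at length r.\<close>

lemma F_mult_T_aux:
  assumes "x \<in> F D" and left: "\<And>i n z. 1 \<le> i \<Longrightarrow> i \<le> D \<Longrightarrow> z \<in> T r \<Longrightarrow> A i n * z \<in> T r" and "z \<in> T r"
  shows "x * z \<in> T (Suc r)"
  using assms(1,3) unfolding F_def
proof (induct arbitrary: z)
  case (J x)
  then show ?case by (intro T_closed J_right)
next
  case (gen x)
  then show ?case using T_y_left by blast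
next
  case (add x x')
  then show ?case using T_closed(2) by (simp add: distrib_right del: T.simps)
next
  case (sc x c)
  then show ?case using T_closed(3) by (simp add: mult_sc_left del: T.simps)
next
  case (right x w)
  then show ?case using left by (auto simp: tail_def mult.assoc simp del: T.simps)
qed

lemma T_left: "1 \<le> i \<Longrightarrow> i \<le> D \<Longrightarrow> x \<in> T r \<Longrightarrow> A i n * x \<in> T r"
proof (induct r arbitrary: i n x)
  case 0
  then show ?case using T_zero_left by blast
next
  case (Suc r)
  from Suc(4) show ?case unfolding T.simps(2)
  proof (rule rspan_mult_left)
    fix g assume "g \<in> {y a m * z |a m z. a \<le> D \<and> z \<in> T r}"
    then obtain a m z where g: "g = y a m * z" "a \<le> D" "z \<in> T r" by blast
    have "A i n * y a m * z \<in> T (Suc r)"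
      using F_mult_T_aux[OF tail_left[OF Suc(2,3) F_y[OF g(2)]] Suc(1) g(3)] by blast
    then show "A i n * g \<in> rspan tail {y a m * z |a m z. a \<le> D \<and> z \<in> T r}"
      by (simp add: g mult.assoc)
  qed
qed

lemma F_mult_T: "x \<in> F D \<Longrightarrow> z \<in> T r \<Longrightarrow> x * z \<in> T (Suc r)"
  using F_mult_T_aux T_left by blast

lemma ordT_subset_T: "x \<in> ordT r a \<Longrightarrow> x \<in> T r"
proof (induct r arbitrary: x a)
  case (Suc r)
  from Suc(2) show ?case unfolding ordT.simps T.simps
    by (rule rspan_subset) (use Suc(1) in \<open>blast intro: rspan.gen\<close>)
qed simp

lemma H_mult_T:
  assumes "x \<in> H d" "z \<in> T r" and *: "\<And>a m z. a \<le> d \<Longrightarrow> z \<in> T (Suc r) \<Longrightarrow> y a m * z \<in> ordT (Suc (Suc r)) b"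
  shows "x * z \<in> ordT (Suc (Suc r)) b"
  using assms(1,2) unfolding H_def
proof (induct arbitrary: z)
  case (J x)
  then show ?case by (intro ordT_closed J_right)
next
  case (gen x)
  then show ?case using * F_mult_T by (auto simp: mult.assoc simp del: T.simps ordT.simps)
next
  case (add x x')
  then show ?case using ordT_closed(2) by (simp add: distrib_right del: ordT.simps)
next
  case (sc x c)
  then show ?case using ordT_closed(3) by (simp add: mult_sc_left del: ordT.simps)
next
  case (right x w)
  then show ?case using T_left by (auto simp: tail_def mult.assoc simp del: ordT.simps T.simps)
qed

text \<open>Straightening replaces two root vectors by two, so the length is invariant. Outer
  induction on the length sorts everything after the first factor; if the first index is then too
  large, straightening lowers it, and the inner induction on that index applies to an arbitrary,
  unsorted rest.\<close>

lemma T_subset_ordT: "x \<in> T r \<Longrightarrow> x \<in> ordT r 0"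
proof (induct r arbitrary: x)
  case (Suc r)
  have main: "y d m * z \<in> ordT (Suc r) 0" if "z \<in> T r" "d \<le> D" for d m z
    using that
  proof (induct d arbitrary: m z rule: less_induct)
    case (less d)
    from less(2) Suc(1) have "z \<in> ordT r 0" by blast
    show ?case
    proof (cases r)
      case 0
      then show ?thesis using ordT_y_left[of z 0 d 0 m] less \<open>z \<in> ordT r 0\<close> by simp
    next
      case (Suc s)
      have "z \<in> rspan tail {y b m * z |b m z. 0 \<le> b \<and> b \<le> D \<and> z \<in> ordT s b}"
        using \<open>z \<in> ordT r 0\<close> by (simp only: Suc ordT.simps(2))
      then have "y d m * z \<in> rspan tail {y b m * z |b m z. 0 \<le> b \<and> b \<le> D \<and> z \<in> ordT (Suc s) b}"
      proof (rule rspan_mult_left)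
        fix g assume "g \<in> {y b m * z |b m z. 0 \<le> b \<and> b \<le> D \<and> z \<in> ordT s b}"
        then obtain b n z' where g: "g = y b n * z'" "b \<le> D" "z' \<in> ordT s b" by blast
        have "y d m * g \<in> ordT (Suc (Suc s)) 0"
        proof (cases "d \<le> b")
          case True
          then have "g \<in> ordT (Suc s) d" using ordT_y_left[OF g(3)] g by simp
          then show ?thesis using ordT_y_left[of g "Suc s" d 0 m] less(3) by simp
        next
          case False
          have "(y d m * y b n) * z' \<in> ordT (Suc (Suc s)) 0"
          proof (rule H_mult_T[OF y_pair_straighten[OF less(3)] ordT_subset_T[OF g(3)]])
            fix a m z assume "a \<le> d - 1" "z \<in> T (Suc s)"
            then show "y a m * z \<in> ordT (Suc (Suc s)) 0"
              using less(1)[of a z m] False less(3) Suc by simp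
          qed (use False in simp)
          then show ?thesis by (simp only: g mult.assoc)
        qed
        then show "y d m * g \<in> rspan tail {y b m * z |b m z. 0 \<le> b \<and> b \<le> D \<and> z \<in> ordT (Suc s) b}"
          by (simp only: ordT.simps(2))
      qed
      then show ?thesis by (simp only: ordT.simps(2) Suc)
    qed
  qed
  from Suc(2) show ?case unfolding T.simps ordT.simps(2)
    by (rule rspan_subset) (use main in auto)
qed simp

end

section \<open>Ordered products of root vectors\<close>

text \<open>Two distinct nodes are never both odd, so distant nodes commute without sign; the sign
  rule is visible only in \<open>E_odd\<close> and in the last bracket of
  \<open>super_serre\<close>.\<close>

locale simple_root_algebra = algebra_mod_ideal sc J
  for sc :: "'f::field_char_0 \<Rightarrow> 'a::ring_1 \<Rightarrow> 'a" and J :: "'a set" +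
  fixes E :: "nat \<Rightarrow> int \<Rightarrow> 'a" and L :: nat and M :: nat
    and k p :: "nat \<Rightarrow> 'f" and t u v :: 'f
  assumes k_nonzero: "k i \<noteq> 0" and p_nonzero: "p i \<noteq> 0" and t_nonzero: "t \<noteq> 0"
    and u_nonzero: "u \<noteq> 0" and v_nonzero: "v \<noteq> 0"
    and E_commuting: "1 \<le> i \<Longrightarrow> i + 2 \<le> j \<Longrightarrow> j < L \<Longrightarrow> commuting (E i m) (E j n)"
    and E_quadratic: "1 \<le> i \<Longrightarrow> i + 1 < L \<Longrightarrow>
      (E i (m + 1) * E (i + 1) n - sc (p i) (E (i + 1) n * E i (m + 1)))
        - (sc (p i) (E i m * E (i + 1) (n + 1)) - E (i + 1) (n + 1) * E i m) \<in> J"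
    and E_odd: "1 \<le> M \<Longrightarrow> M < L \<Longrightarrow> E M m * E M n + E M n * E M m \<in> J"
    and E_serre: "1 \<le> i \<Longrightarrow> i < L \<Longrightarrow> 1 \<le> j \<Longrightarrow> j < L \<Longrightarrow> i = j + 1 \<or> j = i + 1 \<Longrightarrow> i \<noteq> M \<Longrightarrow>
      serre t (E i m) (E i n) (E j l) \<in> J"
    and E_super_serre: "1 < M \<Longrightarrow> M + 1 < L \<Longrightarrow>
      super_serre u v (E M n) (E (M + 1) l) (E (M - 1) m) \<in> J"
begin

text \<open>The bracket is written without its sign: the appended letter and the vector before it
  are not both odd.\<close>

definition root_vec :: "nat \<times> nat \<Rightarrow> int \<Rightarrow> 'a" where
  "root_vec = (\<lambda>(i, j) n. foldl (\<lambda>a l. a * E l 0 - sc (k l) (E l 0 * a)) (E i n) [i + 1..<j + 1])"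

definition root_prod :: "((nat \<times> nat) \<times> int) list \<Rightarrow> 'a" where
  "root_prod l = prod_list (map (\<lambda>(\<beta>, n). root_vec \<beta> n) l)"

definition ordered_from :: "nat \<Rightarrow> ((nat \<times> nat) \<times> int) list set" where
  "ordered_from r = {l. sorted (map fst l) \<and> (\<forall>((i, j), n) \<in> set l. r \<le> i \<and> i \<le> j \<and> j < L)}"

definition words_from :: "nat \<Rightarrow> 'a set" where
  "words_from r = rspan {E i n | i n. r \<le> i \<and> i < L} {1}"

lemma words_from_one: "1 \<in> words_from r"
  unfolding words_from_def by (rule rspan.gen) simp

text \<open>Letters of node r are the root vectors \<open>y 0\<close>, all others form the tail.
  Sorting the row leaves a word in nodes beyond r on the right, to which the hypothesis applies.
  Roots starting at r precede those starting later, so the concatenated lists are sorted.\<close>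

lemma words_from_step:
  assumes r: "1 \<le> r" "r < L" and IH: "words_from (r + 1) \<subseteq> rspan {} (root_prod ` ordered_from (r + 1))"
    and x: "x \<in> words_from r"
  shows "x \<in> rspan {} (root_prod ` ordered_from r)"
proof -
  interpret R: row sc J "\<lambda>d. E (r + d)" "L - 1 - r" "\<lambda>d. r + d = M" "\<lambda>d. k (r + d)" "\<lambda>d. p (r + d)" t u v
  proof
    fix i j :: nat and m n l :: int
    show "commuting (E (r + i) m) (E (r + j) n)" if "i + 2 \<le> j" "j \<le> L - 1 - r"
      using E_commuting[of "r + i" "r + j"] r that by simp
    show "(E (r + i) (m + 1) * E (r + (i + 1)) n - sc (p (r + i)) (E (r + (i + 1)) n * E (r + i) (m + 1)))
        - (sc (p (r + i)) (E (r + i) m * E (r + (i + 1)) (n + 1)) - E (r + (i + 1)) (n + 1) * E (r + i) m) \<in> J"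
      if "i < L - 1 - r"
      using E_quadratic[of "r + i" m n] r that by (simp add: add.assoc)
    show "E (r + i) m * E (r + i) n + E (r + i) n * E (r + i) m \<in> J" if "i \<le> L - 1 - r" "r + i = M"
      using E_odd r that by auto
    show "serre t (E (r + i) m) (E (r + i) n) (E (r + j) l) \<in> J"
      if "i \<le> L - 1 - r" "j \<le> L - 1 - r" "i = j + 1 \<or> j = i + 1" "r + i \<noteq> M"
      using E_serre[of "r + i" "r + j"] r that by auto
    show "super_serre u v (E (r + i) n) (E (r + (i + 1)) l) (E (r + (i - 1)) m) \<in> J"
      if "1 \<le> i" "i < L - 1 - r" "r + i = M"
      using E_super_serre r that by (auto simp: add.assoc)
  qed (rule k_nonzero p_nonzero t_nonzero u_nonzero v_nonzero)+
  let ?D = "L - 1 - r"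
  have y: "R.y d m = root_vec (r, r + d) m" for d m
    by (induct d) (simp_all add: root_vec_def R.y_Suc)
  have tail: "R.tail = {E i n | i n. r + 1 \<le> i \<and> i < L}"
  proof -
    have "\<exists>d. E i n = E (r + d) n' \<and> 1 \<le> d \<and> d \<le> ?D" if "r + 1 \<le> i" "i < L" "n' = n" for i n n'
      using that by (intro exI[of _ "i - r"]) auto
    then show ?thesis unfolding R.tail_def using r by fastforce
  qed
  have words: "words_from (r + 1) = rspan R.tail {1}"
    unfolding words_from_def tail ..
  let ?T = "rspan {} (\<Union>s. R.T s)"
  \<comment> \<open>A letter of node r lengthens the word by one root vector, any other keeps its
    length; hence the union over all lengths.\<close>
  have T_left: "E i n * z \<in> ?T" if z: "z \<in> ?T" and i: "r \<le> i" "i < L" for i n z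
    using z
  proof (rule rspan_mult_left)
    fix g assume "g \<in> (\<Union>s. R.T s)"
    then obtain s where s: "g \<in> R.T s" by blast
    obtain d where "i = r + d" using i(1) le_iff_add by blast
    with i(2) have d: "i = r + d" "d \<le> ?D" by simp_all
    show "E i n * g \<in> ?T"
    proof (cases "d = 0")
      case True
      then have "E i n * g \<in> R.T (Suc s)" using R.T_y_left[OF s, of 0 n] d by simp
      then show ?thesis by (intro rspan.gen) blast
    next
      case False
      then have "E i n * g \<in> R.T s" using R.T_left[of d g s n] s d by simp
      then show ?thesis by (intro rspan.gen) blast
    qed
  qed
  have "x * z \<in> ?T" if "z \<in> ?T" for z
    using x that unfolding words_from_def
  proof (induct arbitrary: z)
    case (J x)
    then show ?case by (intro rspan.J J_right)
  next
    case (right x w)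
    then show ?case using T_left by (auto simp: mult.assoc)
  qed (auto simp: distrib_right mult_sc_left intro: rspan.add rspan.sc)
  moreover have "1 \<in> R.T 0" unfolding R.T.simps by (rule rspan.gen) simp
  then have "1 \<in> ?T" by (blast intro: rspan.gen)
  ultimately have xT: "x \<in> ?T" by (metis mult.right_neutral)
  \<comment> \<open>The lower bound \<open>a\<close> on the last node is what permits a root vector
    ending at node r + a to be put in front.\<close>
  define row_lists :: "nat \<Rightarrow> ((nat \<times> nat) \<times> int) list set" where "row_lists a =
    {l. sorted (map fst l) \<and> (\<forall>((i, j), n) \<in> set l. i = r \<and> r + a \<le> j \<and> j < L)}" for a
  define Q where "Q a = rspan {} {root_prod l * w | l w. l \<in> row_lists a \<and> w \<in> words_from (r + 1)}" for a
  have Q_right: "z * w \<in> Q a" if "z \<in> Q a" "w \<in> R.tail" for z w a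
    using that(1) unfolding Q_def
  proof induct
    case (J x)
    then show ?case by (intro rspan.J J_right)
  next
    case (gen x)
    then obtain l w' where "x = root_prod l * w'" "l \<in> row_lists a" "w' \<in> words_from (r + 1)" by blast
    moreover have "w' * w \<in> words_from (r + 1)"
      using calculation(3) that(2) unfolding words by (rule rspan.right)
    ultimately have "x * w = root_prod l * (w' * w)" "l \<in> row_lists a" "w' * w \<in> words_from (r + 1)"
      by (simp_all only: mult.assoc)
    then show ?case by (blast intro: rspan.gen)
  qed (auto simp: distrib_right mult_sc_left intro: rspan.add rspan.sc)
  have ordT_Q: "z \<in> Q a" if "z \<in> R.ordT s a" for s a z
    using that
  proof (induct s arbitrary: z a)
    case 0
    then have "z \<in> words_from (r + 1)" by (simp only: R.ordT.simps words)
    moreover have "[] \<in> row_lists a" by (simp add: row_lists_def)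
    ultimately have "root_prod [] * z \<in> Q a" unfolding Q_def by (blast intro: rspan.gen)
    then show ?case by (simp add: root_prod_def)
  next
    case (Suc s)
    from Suc(2) show ?case unfolding R.ordT.simps(2)
    proof induct
      case (gen x)
      then obtain b m z where x: "x = R.y b m * z" "a \<le> b" "b \<le> ?D" "z \<in> R.ordT s b" by blast
      from Suc(1)[OF x(4)] have "R.y b m * z \<in> Q a" unfolding Q_def
      proof (rule rspan_mult_left)
        fix g assume "g \<in> {root_prod l * w | l w. l \<in> row_lists b \<and> w \<in> words_from (r + 1)}"
        then obtain l w where g: "g = root_prod l * w" "l \<in> row_lists b" "w \<in> words_from (r + 1)" by blast
        have "((r, r + b), m) # l \<in> row_lists a"
          using g(2) x(2,3) r unfolding row_lists_def by (force simp: less_eq_prod_def)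
        moreover have "R.y b m * g = root_prod (((r, r + b), m) # l) * w"
          by (simp add: g y root_prod_def mult.assoc)
        ultimately show "R.y b m * g \<in> rspan {} {root_prod l * w | l w. l \<in> row_lists a \<and> w \<in> words_from (r + 1)}"
          using g(3) by (intro rspan.gen) blast
      qed
      then show ?case by (simp add: x)
    next
      case (right x w)
      then show ?case by (blast intro: Q_right)
    qed (auto simp: Q_def intro: rspan.intros)
  qed
  have Q_sub: "z \<in> rspan {} (root_prod ` ordered_from r)" if "z \<in> Q 0" for z
    using that unfolding Q_def
  proof induct
    case (gen x)
    then obtain l w where x: "x = root_prod l * w" "l \<in> row_lists 0" "w \<in> words_from (r + 1)" by blast
    from x(3) IH have "w \<in> rspan {} (root_prod ` ordered_from (r + 1))" by blast
    then have "root_prod l * w \<in> rspan {} (root_prod ` ordered_from r)"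
    proof (rule rspan_mult_left)
      fix g assume "g \<in> root_prod ` ordered_from (r + 1)"
      then obtain l' where l': "g = root_prod l'" "l' \<in> ordered_from (r + 1)" by blast
      have "l @ l' \<in> ordered_from r"
        using x(2) l'(2) unfolding ordered_from_def row_lists_def
        by (fastforce simp: sorted_append less_eq_prod_def)
      then show "root_prod l * g \<in> rspan {} (root_prod ` ordered_from r)"
        by (intro rspan.gen) (auto simp: l' root_prod_def intro!: image_eqI[of _ _ "l @ l'"])
    qed
    then show ?case by (simp add: x)
  qed (auto intro: rspan.intros)
  from xT show ?thesis
    by (rule rspan_subset) (use R.T_subset_ordT ordT_Q Q_sub in blast)
qed

theorem words_from_subset_ordered:
  "1 \<le> r \<Longrightarrow> r \<le> L \<Longrightarrow> words_from r \<subseteq> rspan {} (root_prod ` ordered_from r)"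
proof (induct "L - r" arbitrary: r)
  case 0
  then have no_gens: "{E i n | i n. r \<le> i \<and> i < L} = {}" by auto
  have "words_from r = rspan {} {1}" unfolding words_from_def no_gens ..
  moreover have "1 \<in> root_prod ` ordered_from r"
    by (rule image_eqI[of _ _ "[]"]) (simp_all add: root_prod_def ordered_from_def)
  ultimately show ?case by (auto elim!: rspan_subset intro: rspan.gen)
next
  case (Suc d)
  then have "words_from (r + 1) \<subseteq> rspan {} (root_prod ` ordered_from (r + 1))" by simp
  then show ?case using words_from_step[of r] Suc by auto
qed

end

section \<open>Sorted lists and block products\<close>

lemma sorted_split_min:
  assumes "sorted (map f l)" "\<And>x. x \<in> set l \<Longrightarrow> b \<le> f x"
  shows "filter (\<lambda>x. f x = b) l @ filter (\<lambda>x. f x \<noteq> b) l = l"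
  using assms
proof (induct l)
  case (Cons x l)
  show ?case
  proof (cases "f x = b")
    case False
    then have "\<forall>z \<in> set l. f z \<noteq> b" using Cons(2,3) by force
    then have "filter (\<lambda>x. f x = b) l = []" "filter (\<lambda>x. f x \<noteq> b) l = l"
      by (auto simp: filter_empty_conv filter_id_conv)
    then show ?thesis using False by simp
  qed (use Cons in auto)
qed simp

lemma concat_filter_sorted:
  assumes "sorted_wrt (<) bs" "sorted (map f l)" "f ` set l \<subseteq> set bs"
  shows "concat (map (\<lambda>b. filter (\<lambda>x. f x = b) l) bs) = (l :: 'a list)"
  using assms
proof (induct bs arbitrary: l)
  case (Cons b bs)
  let ?l = "filter (\<lambda>x. f x \<noteq> b) l"
  have "b \<notin> set bs" using Cons(2) by auto
  then have "map (\<lambda>c. filter (\<lambda>x. f x = c) l) bs = map (\<lambda>c. filter (\<lambda>x. f x = c) ?l) bs"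
    by (intro map_cong refl) (auto intro!: filter_cong simp: filter_filter)
  moreover have "concat (map (\<lambda>c. filter (\<lambda>x. f x = c) ?l) bs) = ?l"
    by (rule Cons(1)) (use Cons(2-) in \<open>auto simp: sorted_filter\<close>)
  moreover have "filter (\<lambda>x. f x = b) l @ ?l = l"
    by (rule sorted_split_min[OF Cons(3)]) (use Cons(2,4) in fastforce)
  ultimately show ?case by (simp only: list.map concat.simps)
qed simp

text \<open>This passes from lists to the functions of the ordered product: \<open>m b\<close> is
  the length of the block of \<open>b\<close>, and \<open>n\<close> reads off its second
  components.\<close>

lemma sorted_list_blocks:
  fixes l :: "('b::linorder \<times> 'c) list"
  assumes "finite R" "sorted (map fst l)" "fst ` set l \<subseteq> R"
  shows "\<exists>m n. concat (map (\<lambda>b. map (\<lambda>i. g b (n i b)) [1..<m b + 1]) (sorted_list_of_set R))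
    = map (\<lambda>(b, c). g b c) l"
proof -
  define blk where "blk b = filter (\<lambda>x. fst x = b) l" for b
  \<comment> \<open>Positions in an ordered product start at 1 and list positions at 0, hence
    \<open>i - 1\<close>.\<close>
  have "map (\<lambda>i. g b (snd (blk b ! (i - 1)))) [1..<length (blk b) + 1] = map (\<lambda>(b, c). g b c) (blk b)" for b
  proof (rule nth_equalityI)
    fix i assume "i < length (map (\<lambda>i. g b (snd (blk b ! (i - 1)))) [1..<length (blk b) + 1])"
    then have i: "i < length (blk b)" by (simp del: upt_Suc)
    then have "fst (blk b ! i) = b" using nth_mem[OF i] by (auto simp: blk_def)
    then show "map (\<lambda>i. g b (snd (blk b ! (i - 1)))) [1..<length (blk b) + 1] ! i
        = map (\<lambda>(b, c). g b c) (blk b) ! i"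
      using i by (simp add: case_prod_unfold del: upt_Suc)
  qed (simp del: upt_Suc)
  moreover have "concat (map blk (sorted_list_of_set R)) = l"
    unfolding blk_def using assms by (intro concat_filter_sorted) auto
  then have "map (\<lambda>(b, c). g b c) l = map (\<lambda>(b, c). g b c) (concat (map blk (sorted_list_of_set R)))" by simp
  then have "concat (map (\<lambda>b. map (\<lambda>(b, c). g b c) (blk b)) (sorted_list_of_set R)) = map (\<lambda>(b, c). g b c) l"
    by (simp only: map_concat map_map comp_def)
  ultimately show ?thesis
    by (intro exI[of _ "\<lambda>b. length (blk b)"] exI[of _ "\<lambda>i b. snd (blk b ! (i - 1))"]) simp
qed

lemma list_product_concat:
  assumes "Group.monoid G" "\<And>xs. xs \<in> set xss \<Longrightarrow> set xs \<subseteq> carrier G"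
  shows "list_product G (map (list_product G) xss) = list_product G (concat xss)"
proof -
  interpret Group.monoid G by fact
  have closed: "list_product G xs \<in> carrier G" if "set xs \<subseteq> carrier G" for xs
    using that by (induct xs) (auto simp: list_product_def)
  have app: "list_product G (xs @ ys) = list_product G xs \<otimes>\<^bsub>G\<^esub> list_product G ys"
    if "set xs \<subseteq> carrier G" "set ys \<subseteq> carrier G" for xs ys
    using that closed[of ys] closed by (induct xs) (simp_all add: list_product_def m_assoc)
  show ?thesis using assms(2)
  proof (induct xss)
    case (Cons xs xss)
    then have "set (concat xss) \<subseteq> carrier G" by auto
    with Cons show ?case by (simp add: app) (simp add: list_product_def)
  qed (simp add: list_product_def)
qed

section \<open>The free algebra on the generators\<close>

lemma cst_add: "cst (a + b) = cst a + cst b"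
  by (simp add: cst_def single_add)

lemma cst_mult: "cst (a * b) = cst a * cst b"
  by (simp add: cst_def mult_single)

lemma cst_one: "cst 1 = 1"
  by (simp add: cst_def)

lemma cst_minus: "cst (- a) = - cst a"
  by (simp add: cst_def single_uminus)

lemma cst_commute: "cst c * a = a * cst c"
proof -
  have "cst c * a = (\<Sum>w \<in> Poly_Mapping.keys a. cst c * Poly_Mapping.single w (Poly_Mapping.lookup a w))"
    by (subst poly_mapping_sum_single[of a, symmetric]) (simp add: sum_distrib_left)
  also have "\<dots> = (\<Sum>w \<in> Poly_Mapping.keys a. Poly_Mapping.single w (Poly_Mapping.lookup a w) * cst c)"
    by (simp add: cst_def mult_single mult.commute)
  also have "\<dots> = a * cst c"
    by (simp flip: sum_distrib_right add: poly_mapping_sum_single)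
  finally show ?thesis .
qed

lemma letters_add: "letters (v + w) = letters v @ letters w"
  by (simp add: plus_word_def)

lemma letters_zero: "letters 0 = []"
  by (simp add: zero_word_def)

definition free_carrier :: "nat \<Rightarrow> nat \<Rightarrow> free set" where
  "free_carrier M N = {a. \<forall>w \<in> Poly_Mapping.keys a. set (letters w) \<subseteq> gens M N}"

text \<open>A multiplicative retraction of the whole type onto the carrier. Through it the quotient
  can be treated as a quotient of the type, without tracking carrier membership.\<close>

definition restrict_gens :: "nat \<Rightarrow> nat \<Rightarrow> free \<Rightarrow> free" where
  "restrict_gens M N a =
     (\<Sum>w \<in> {w \<in> Poly_Mapping.keys a. set (letters w) \<subseteq> gens M N}. Poly_Mapping.single w (Poly_Mapping.lookup a w))"

lemma lookup_restrict_gens: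
  "Poly_Mapping.lookup (restrict_gens M N a) w = (if set (letters w) \<subseteq> gens M N then Poly_Mapping.lookup a w else 0)"
  by (auto simp: restrict_gens_def lookup_sum lookup_single when_def sum.delta in_keys_iff)

lemma restrict_gens_id: "a \<in> free_carrier M N \<Longrightarrow> restrict_gens M N a = a"
  by (rule poly_mapping_eqI) (auto simp: free_carrier_def lookup_restrict_gens in_keys_iff)

lemma restrict_gens_mem: "restrict_gens M N a \<in> free_carrier M N"
  by (auto simp: free_carrier_def lookup_restrict_gens in_keys_iff split: if_splits)

lemma restrict_gens_zero: "restrict_gens M N 0 = 0"
  by (rule poly_mapping_eqI) (simp add: lookup_restrict_gens)

lemma restrict_gens_add: "restrict_gens M N (a + b) = restrict_gens M N a + restrict_gens M N b"
  by (rule poly_mapping_eqI) (simp add: lookup_restrict_gens lookup_add)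

lemma restrict_gens_sum: "restrict_gens M N (\<Sum>x\<in>S. f x) = (\<Sum>x\<in>S. restrict_gens M N (f x))"
  by (induct S rule: infinite_finite_induct) (simp_all add: restrict_gens_zero restrict_gens_add)

lemma restrict_gens_single:
  "restrict_gens M N (Poly_Mapping.single w c) = (if set (letters w) \<subseteq> gens M N then Poly_Mapping.single w c else 0)"
  by (rule poly_mapping_eqI) (auto simp: lookup_restrict_gens lookup_single when_def)

text \<open>A concatenation avoids foreign letters exactly when both factors do; bilinearity reduces
  the claim to single words.\<close>

lemma restrict_gens_mult: "restrict_gens M N (a * b) = restrict_gens M N a * restrict_gens M N b"
proof -
  let ?s = "\<lambda>a w. Poly_Mapping.single w (Poly_Mapping.lookup a w)"
  have single: "restrict_gens M N (?s a v * ?s b w) = restrict_gens M N (?s a v) * restrict_gens M N (?s b w)" for v w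
    by (simp add: mult_single restrict_gens_single letters_add)
  have "a * b = (\<Sum>v \<in> Poly_Mapping.keys a. \<Sum>w \<in> Poly_Mapping.keys b. ?s a v * ?s b w)"
    by (simp only: sum_product[symmetric] poly_mapping_sum_single)
  then have "restrict_gens M N (a * b) =
      (\<Sum>v \<in> Poly_Mapping.keys a. \<Sum>w \<in> Poly_Mapping.keys b. restrict_gens M N (?s a v) * restrict_gens M N (?s b w))"
    by (simp only: restrict_gens_sum single)
  also have "\<dots> = restrict_gens M N a * restrict_gens M N b"
    by (simp only: sum_product[symmetric] restrict_gens_sum[symmetric] poly_mapping_sum_single)
  finally show ?thesis .
qed

lemma free_carrier_zero: "0 \<in> free_carrier M N" and free_carrier_one: "1 \<in> free_carrier M N" and free_carrier_cst: "cst c \<in> free_carrier M N"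
  by (auto simp: free_carrier_def cst_def letters_zero)

lemma free_carrier_add: "a \<in> free_carrier M N \<Longrightarrow> b \<in> free_carrier M N \<Longrightarrow> a + b \<in> free_carrier M N"
  unfolding free_carrier_def using keys_add[of a b] by blast

lemma free_carrier_mult:
  assumes "a \<in> free_carrier M N" "b \<in> free_carrier M N" shows "a * b \<in> free_carrier M N"
  using restrict_gens_mem[of M N "a * b"] assms by (simp add: restrict_gens_mult restrict_gens_id)

lemma free_carrier_cst_mult: "a \<in> free_carrier M N \<Longrightarrow> cst c * a \<in> free_carrier M N"
  by (rule free_carrier_mult[OF free_carrier_cst])

lemma free_carrier_uminus: "a \<in> free_carrier M N \<Longrightarrow> - a \<in> free_carrier M N"
  using free_carrier_cst_mult[of a M N "-1"] by (simp add: cst_minus cst_one)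

lemma free_carrier_diff: "a \<in> free_carrier M N \<Longrightarrow> b \<in> free_carrier M N \<Longrightarrow> a - b \<in> free_carrier M N"
  using free_carrier_add[of a M N "- b"] free_carrier_uminus[of b M N] by simp

lemma free_carrier_sum: "(\<And>x. x \<in> S \<Longrightarrow> f x \<in> free_carrier M N) \<Longrightarrow> (\<Sum>x\<in>S. f x) \<in> free_carrier M N"
  by (induct S rule: infinite_finite_induct) (simp_all add: free_carrier_zero free_carrier_add)

lemma free_carrier_gvar: "g \<in> gens M N \<Longrightarrow> gvar g \<in> free_carrier M N"
  by (simp add: free_carrier_def gvar_def)

lemma free_carrier_component: "a \<in> free_carrier M N \<Longrightarrow> component K p a \<in> free_carrier M N"
  unfolding component_def by (rule free_carrier_sum) (auto simp: free_carrier_def)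

lemma free_carrier_br: "a \<in> free_carrier M N \<Longrightarrow> b \<in> free_carrier M N \<Longrightarrow> br K c a b \<in> free_carrier M N"
  unfolding br_def by (intro free_carrier_sum free_carrier_diff free_carrier_mult free_carrier_cst free_carrier_component)

lemmas free_carrier_intros = free_carrier_zero free_carrier_one free_carrier_add free_carrier_diff free_carrier_mult free_carrier_cst free_carrier_br free_carrier_gvar free_carrier_sum

lemma free_carrier_fps_power: "(\<And>n. fps_nth f n \<in> free_carrier M N) \<Longrightarrow> fps_nth (f ^ k) n \<in> free_carrier M N"
proof (induct k arbitrary: n)
  case 0
  then show ?case by (simp add: free_carrier_zero free_carrier_one)
next
  case (Suc k)
  then show ?case unfolding power_Suc fps_mult_nth by (intro free_carrier_intros) auto
qed

lemma free_carrier_phi: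
  assumes "i \<in> {1..<M + N}" shows "phi q K \<sigma> i n \<in> free_carrier M N"
proof -
  have K: "Kgen \<sigma> i \<in> free_carrier M N" by (rule free_carrier_gvar) (use assms in \<open>auto simp: gens_def\<close>)
  have "fps_nth (h_series q K \<sigma> i) s \<in> free_carrier M N" for s
  proof (cases "s = 0")
    case True
    then show ?thesis by (simp add: h_series_def free_carrier_zero)
  next
    case False
    then have "sg \<sigma> * int s \<noteq> 0" by (cases \<sigma>) auto
    then have "hgen i (sg \<sigma> * int s) \<in> free_carrier M N"
      using assms by (intro free_carrier_gvar) (auto simp: gens_def)
    from free_carrier_cst_mult[OF this] False show ?thesis by (simp add: h_series_def)
  qed
  then have "fps_nth (Abs_fps (\<lambda>k. cst (1 / fact k)) oo h_series q K \<sigma> i) s \<in> free_carrier M N" for s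
    unfolding fps_compose_nth fps_nth_Abs_fps by (intro free_carrier_intros free_carrier_fps_power)
  from free_carrier_mult[OF K this] have "fps_nth (phi_series q K \<sigma> i) s \<in> free_carrier M N" for s
    unfolding phi_series_def by simp
  then show ?thesis by (simp add: phi_def free_carrier_zero)
qed

lemma gens_mem:
  "i \<in> {1..<M + N} \<Longrightarrow> Gen_X \<sigma> i n \<in> gens M N"
  "i \<in> {1..<M + N} \<Longrightarrow> Gen_K \<sigma> i \<in> gens M N"
  "i \<in> {1..<M + N} \<Longrightarrow> s \<noteq> 0 \<Longrightarrow> Gen_h i s \<in> gens M N"
  by (auto simp: gens_def)

text \<open>The generated ideal is an ideal of the carrier ring by a result that asks its generators
  to lie in the carrier.\<close>

lemma relation_free_carrier:
  assumes "relation q M N a b"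
  shows "a \<in> free_carrier M N \<and> b \<in> free_carrier M N"
  using assms
proof cases
  case (X_X_cartan i j m n)
  then show ?thesis
    by (cases "i = j") (simp_all only: if_True if_False simp_thms, (intro conjI free_carrier_intros gens_mem free_carrier_phi; assumption)+)
next
  case (X_super_Serre \<sigma> m n k u)
  then have "M - 1 \<in> {1..<M + N}" "M \<in> {1..<M + N}" "M + 1 \<in> {1..<M + N}" by auto
  with X_super_Serre(1,2) show ?thesis by (simp only:) (intro conjI free_carrier_intros gens_mem; assumption)
qed (simp only:, intro conjI free_carrier_intros gens_mem; assumption)+


section \<open>The quotient algebra and its projection\<close>

lemma free_algebra_simps:
  "carrier (free_algebra M N) = free_carrier M N" "a \<oplus>\<^bsub>free_algebra M N\<^esub> b = a + b"
  "a \<otimes>\<^bsub>free_algebra M N\<^esub> b = a * b" "\<zero>\<^bsub>free_algebra M N\<^esub> = 0" "\<one>\<^bsub>free_algebra M N\<^esub> = 1"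
  by (simp_all add: free_carrier_def free_algebra_def ring_of_type_algebra_def)

lemma ring_free_algebra: "ring (free_algebra M N)"
proof -
  have "abelian_group (free_algebra M N)"
  proof (rule abelian_groupI)
    show "\<exists>b\<in>carrier (free_algebra M N). b \<oplus>\<^bsub>free_algebra M N\<^esub> a = \<zero>\<^bsub>free_algebra M N\<^esub>"
      if "a \<in> carrier (free_algebra M N)" for a
      using that free_carrier_uminus[of a M N]
      by (intro bexI[of _ "- a"]) (simp_all add: free_algebra_simps)
  qed (simp_all add: free_algebra_simps free_carrier_add free_carrier_zero add.assoc add.commute)
  moreover have "Group.monoid (free_algebra M N)"
    by (rule monoidI) (use free_carrier_mult[of _ M N] free_carrier_one[of M N] in
      \<open>simp_all add: free_algebra_simps mult.assoc\<close>)
  ultimately show ?thesis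
    by (rule ringI) (simp_all add: free_algebra_simps algebra_simps)
qed

lemma ideal_rel_ideal: "ideal (rel_ideal q M N) (free_algebra M N)"
  unfolding rel_ideal_def
proof (rule ring.genideal_ideal[OF ring_free_algebra])
  show "{a - b | a b. relation q M N a b} \<subseteq> carrier (free_algebra M N)"
  proof
    fix x assume "x \<in> {a - b | a b. relation q M N a b}"
    then obtain a b where "x = a - b" "relation q M N a b" by blast
    then show "x \<in> carrier (free_algebra M N)"
      unfolding free_algebra_simps using relation_free_carrier free_carrier_diff by metis
  qed
qed

lemma relation_rel_ideal: "relation q M N a b \<Longrightarrow> a - b \<in> rel_ideal q M N"
proof -
  assume r: "relation q M N a b"
  have "{a - b | a b. relation q M N a b} \<subseteq> carrier (free_algebra M N)"
    unfolding free_algebra_simps using relation_free_carrier free_carrier_diff by fast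
  from ring.genideal_self[OF ring_free_algebra this] r show ?thesis
    unfolding rel_ideal_def by blast
qed

text \<open>A total version of \<open>proj\<close>: additive and multiplicative on the whole type,
  and equal to \<open>proj\<close> on the carrier.\<close>

definition quot :: "complex \<Rightarrow> nat \<Rightarrow> nat \<Rightarrow> free \<Rightarrow> free set" where
  "quot q M N a = proj q M N (restrict_gens M N a)"

lemma restrict_gens_carrier: "restrict_gens M N a \<in> carrier (free_algebra M N)"
  unfolding free_algebra_simps by (rule restrict_gens_mem)

lemma proj_hom: "proj q M N \<in> ring_hom (free_algebra M N) (U_ring q M N)"
  using ideal.rcos_ring_hom[OF ideal_rel_ideal] by (simp add: proj_def[abs_def])

lemma ring_U: "ring (U_ring q M N)"
  by (rule ideal.quotient_is_ring[OF ideal_rel_ideal])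

lemma quot_closed: "quot q M N a \<in> carrier (U_ring q M N)"
  unfolding quot_def by (rule ring_hom_closed[OF proj_hom restrict_gens_carrier])

lemma quot_add: "quot q M N (a + b) = quot q M N a \<oplus>\<^bsub>U_ring q M N\<^esub> quot q M N b"
  unfolding quot_def restrict_gens_add
  using ring_hom_add[OF proj_hom restrict_gens_carrier restrict_gens_carrier, of q M N a b]
  by (simp add: free_algebra_simps)

lemma quot_mult: "quot q M N (a * b) = quot q M N a \<otimes>\<^bsub>U_ring q M N\<^esub> quot q M N b"
  unfolding quot_def restrict_gens_mult
  using ring_hom_mult[OF proj_hom restrict_gens_carrier restrict_gens_carrier, of q M N a b]
  by (simp add: free_algebra_simps)

lemma quot_free_carrier: "a \<in> free_carrier M N \<Longrightarrow> quot q M N a = proj q M N a"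
  by (simp only: quot_def restrict_gens_id)

lemma quot_one: "quot q M N 1 = \<one>\<^bsub>U_ring q M N\<^esub>"
  using ring_hom_one[OF proj_hom, of q M N] by (simp only: quot_free_carrier[OF free_carrier_one] free_algebra_simps)

lemma quot_rel_ideal: "restrict_gens M N a \<in> rel_ideal q M N \<Longrightarrow> quot q M N a = \<zero>\<^bsub>U_ring q M N\<^esub>"
  by (simp add: quot_def proj_def FactRing_def abelian_subgroup.a_rcos_const[OF
      abelian_subgroupI3[OF ideal.axioms(1)[OF ideal_rel_ideal] ring.axioms(1)[OF ring_free_algebra]]])

lemma Uq_simps:
  "carrier (Uq q M N) = carrier (U_ring q M N)" "\<zero>\<^bsub>Uq q M N\<^esub> = \<zero>\<^bsub>U_ring q M N\<^esub>"
  "\<one>\<^bsub>Uq q M N\<^esub> = \<one>\<^bsub>U_ring q M N\<^esub>"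
  "x \<oplus>\<^bsub>Uq q M N\<^esub> y = x \<oplus>\<^bsub>U_ring q M N\<^esub> y" "x \<otimes>\<^bsub>Uq q M N\<^esub> y = x \<otimes>\<^bsub>U_ring q M N\<^esub> y"
  "c \<odot>\<^bsub>Uq q M N\<^esub> x = proj q M N (cst c) \<otimes>\<^bsub>U_ring q M N\<^esub> x"
  by (simp_all add: Uq_def ring.defs module.defs)

lemma quot_smult: "c \<odot>\<^bsub>Uq q M N\<^esub> quot q M N a = quot q M N (cst c * a)"
  by (simp only: Uq_simps quot_mult quot_free_carrier[OF free_carrier_cst])

section \<open>Parity and the relations of the quantum loop superalgebra\<close>

lemma parity_add: "parity K (v + w) = (parity K v + parity K w) mod 2"
  by (simp add: parity_def letters_add mod_add_eq)

lemma homogeneous_mult: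
  assumes "homogeneous K p a" "homogeneous K r b"
  shows "homogeneous K ((p + r) mod 2) (a * b)"
  using assms keys_mult[of a b] unfolding homogeneous_def by (fastforce simp: parity_add)

lemma homogeneous_diff: "homogeneous K p a \<Longrightarrow> homogeneous K p b \<Longrightarrow> homogeneous K p (a - b)"
  using keys_diff[of a b] unfolding homogeneous_def by blast

lemma homogeneous_cst_mult:
  assumes "homogeneous K p a" "p < 2"
  shows "homogeneous K p (cst c * a)"
proof -
  have "homogeneous K 0 (cst c)"
    by (simp add: homogeneous_def cst_def parity_def letters_zero)
  from homogeneous_mult[OF this assms(1)] assms(2) show ?thesis by simp
qed

lemma homogeneous_Xgen: "homogeneous K (if i = K then 1 else 0) (Xgen \<sigma> i n)"
  by (simp add: homogeneous_def gvar_def parity_def odd_gen_def)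

lemma homogeneous_br:
  assumes "homogeneous K p a" "homogeneous K r b" "p < 2" "r < 2"
  shows "homogeneous K ((p + r) mod 2) (br K c a b)"
  unfolding br_homogeneous[OF assms]
  using homogeneous_mult[OF assms(2,1)]
  by (intro homogeneous_diff homogeneous_mult[OF assms(1,2)] homogeneous_cst_mult) (simp_all add: add.commute)

lemma br_even:
  assumes "homogeneous K p a" "homogeneous K r b" "p = 0 \<and> r < 2 \<or> r = 0 \<and> p < 2"
  shows "br K c a b = a * b - cst c * (b * a)" "homogeneous K (p + r) (br K c a b)"
  using br_homogeneous[OF assms(1,2), of c] homogeneous_br[OF assms(1,2), of c] assms(3) by auto

lemma br_odd:
  assumes "homogeneous K 1 a" "homogeneous K 1 b"
  shows "br K c a b = a * b + cst c * (b * a)"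
  using br_homogeneous[OF assms, of c] by (simp add: cst_minus)

lemma Xgen_even: "i \<noteq> K \<Longrightarrow> homogeneous K 0 (Xgen \<sigma> i n)"
  using homogeneous_Xgen[of K i] by simp

lemma Xgen_odd: "homogeneous K 1 (Xgen \<sigma> K n)"
  using homogeneous_Xgen[of K K] by simp

text \<open>Adjacent simple roots share only the basis vector of index i + 1, with opposite signs.
  The value is thus 1 or -1, as the quadratic and Serre relations require.\<close>

lemma cform_adjacent:
  "1 \<le> i \<Longrightarrow> cform K i (i + 1) = - ell K (i + 1)" "1 \<le> i \<Longrightarrow> cform K (i + 1) i = - ell K (i + 1)"
  by (simp_all add: cform_def eps_form_def)

lemma ell_cases: "ell K i = 1 \<or> ell K i = -1"
  by (simp add: ell_def)

text \<open>The ideal of relations lives in the carrier of the free algebra. Its preimage under the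
  homomorphism that kills the letters outside \<^const>\<open>gens\<close> is an ideal of the whole type.\<close>

definition relation_ideal :: "complex \<Rightarrow> nat \<Rightarrow> nat \<Rightarrow> free set" where
  "relation_ideal q M N = {a. restrict_gens M N a \<in> rel_ideal q M N}"

lemma relation_mem:
  assumes "relation q M N a b"
  shows "a - b \<in> relation_ideal q M N"
proof -
  have "a - b \<in> free_carrier M N" using relation_free_carrier[OF assms] free_carrier_diff by blast
  then show ?thesis using relation_rel_ideal[OF assms] by (simp add: relation_ideal_def restrict_gens_id)
qed

lemma relation_zero_mem: "relation q M N a 0 \<Longrightarrow> a \<in> relation_ideal q M N"
  using relation_mem[of q M N a 0] by simp

lemma algebra_mod_relation_ideal:
  "algebra_mod_ideal (\<lambda>c a. cst c * a) (relation_ideal q M N)"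
proof
  note I = additive_subgroup.zero_closed[OF ideal.axioms(1)[OF ideal_rel_ideal]]
    additive_subgroup.a_closed[OF ideal.axioms(1)[OF ideal_rel_ideal]]
    ideal.I_l_closed[OF ideal_rel_ideal _ restrict_gens_carrier] ideal.I_r_closed[OF ideal_rel_ideal _ restrict_gens_carrier]
  note I = I[unfolded free_algebra_simps]
  fix c d :: complex and x y z :: free
  show "x * (cst c * y) = cst c * (x * y)"
    by (simp only: mult.assoc[symmetric] cst_commute[of c x])
  show "0 \<in> relation_ideal q M N"
    using I(1) by (simp add: relation_ideal_def restrict_gens_zero)
  show "x + y \<in> relation_ideal q M N" if "x \<in> relation_ideal q M N" "y \<in> relation_ideal q M N"
    using that I(2) by (simp add: relation_ideal_def restrict_gens_add)
  show "z * x \<in> relation_ideal q M N" if "x \<in> relation_ideal q M N"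
    using that I(3) by (simp add: relation_ideal_def restrict_gens_mult)
  show "x * z \<in> relation_ideal q M N" if "x \<in> relation_ideal q M N"
    using that I(4) by (simp add: relation_ideal_def restrict_gens_mult)
qed (simp_all add: cst_add cst_mult cst_one distrib_left distrib_right mult.assoc)

text \<open>Each word with \<open>Y\<close> in the middle arises twice, with coefficients -q and
  -q^{-1}; this is the origin of \<open>t\<close>. In words with \<open>Y\<close> in front the two
  factors cancel.\<close>

lemma (in algebra_mod_ideal) serre_brackets:
  assumes "q \<noteq> 0"
  shows "a * (b * Y - sc (inverse q) (Y * b)) - sc q ((b * Y - sc (inverse q) (Y * b)) * a) +
    (b * (a * Y - sc (inverse q) (Y * a)) - sc q ((a * Y - sc (inverse q) (Y * a)) * b)) =
    serre (q + inverse q) a b Y"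
  unfolding serre_def using assms by (simp add: algebra_simps sc_simps sc_add_left sc_one)

lemma q_not_root:
  fixes q :: complex
  assumes "q \<noteq> 0" "\<forall>k>0. q ^ k \<noteq> 1"
  shows "q + inverse q \<noteq> 0"
proof
  assume "q + inverse q = 0"
  then have "q * (q + inverse q) = 0" by simp
  then have "q * q + 1 = 0" using assms(1) by (simp add: distrib_left)
  then have "q * q = -1" by (simp add: eq_neg_iff_add_eq_0)
  then have "q ^ 4 = (-1) * (-1)" by (simp add: power4_eq_xxxx)
  then have "q ^ 4 = 1" by simp
  then show False using assms(2) by simp
qed

text \<open>The scalars are, in order, the bracket parameters of the root vectors, the quadratic
  coefficients, the Serre coefficient, and the parameters of the two inner super Serre
  brackets.\<close>

lemma simple_root_algebra_relation_ideal:
  assumes "q \<noteq> 0" "\<forall>k>0. q ^ k \<noteq> 1"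
  shows "simple_root_algebra (\<lambda>c a. cst c * a) (relation_ideal q M N) (Xgen Pos) (M + N) M
    (qi q M) (\<lambda>i. q powi cform M i (i + 1)) (q + inverse q) (inverse q) q"
proof -
  interpret algebra_mod_ideal "\<lambda>c a. cst c * a" "relation_ideal q M N"
    by (rule algebra_mod_relation_ideal)
  show ?thesis
  proof
    fix i j :: nat and m n l :: int
    show "qi q M i \<noteq> 0" using assms by (simp add: qi_def)
    show "q powi cform M i (i + 1) \<noteq> 0" using assms by simp
    show "q + inverse q \<noteq> 0" using q_not_root assms by blast
    show "inverse q \<noteq> 0" "q \<noteq> 0" using assms by simp_all
    show "commuting (Xgen Pos i m) (Xgen Pos j n)" if "1 \<le> i" "i + 2 \<le> j" "j < M + N"
    proof -
      have "relation q M N (br M 1 (Xgen Pos i m) (Xgen Pos j n)) 0"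
        by (rule X_X_orthogonal) (use that in \<open>simp_all add: cform_def eps_form_def\<close>)
      moreover have "br M 1 (Xgen Pos i m) (Xgen Pos j n) = Xgen Pos i m * Xgen Pos j n - cst 1 * (Xgen Pos j n * Xgen Pos i m)"
        by (rule br_even(1)[OF homogeneous_Xgen homogeneous_Xgen]) (use that in auto)
      ultimately show ?thesis
        unfolding commuting_def using relation_zero_mem by (simp add: cst_one)
    qed
    show "(Xgen Pos i (m + 1) * Xgen Pos (i + 1) n
          - cst (q powi cform M i (i + 1)) * (Xgen Pos (i + 1) n * Xgen Pos i (m + 1)))
        - (cst (q powi cform M i (i + 1)) * (Xgen Pos i m * Xgen Pos (i + 1) (n + 1))
          - Xgen Pos (i + 1) (n + 1) * Xgen Pos i m) \<in> relation_ideal q M N"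
      if "1 \<le> i" "i + 1 < M + N"
    proof -
      have "cform M i (i + 1) \<noteq> 0" using cform_adjacent(1)[OF that(1), of M] ell_cases[of M "i + 1"] by auto
      from relation_mem[OF X_X_quadratic[where \<sigma> = Pos, OF _ _ this]] that
      show ?thesis by simp
    qed
    show "Xgen Pos M m * Xgen Pos M n + Xgen Pos M n * Xgen Pos M m \<in> relation_ideal q M N"
      if "1 \<le> M" "M < M + N"
    proof -
      have "relation q M N (br M 1 (Xgen Pos M m) (Xgen Pos M n)) 0"
        by (rule X_X_orthogonal) (use that in \<open>simp_all add: cform_def eps_form_def ell_def\<close>)
      from relation_zero_mem[OF this] show ?thesis by (simp add: br_odd[OF Xgen_odd Xgen_odd] cst_one)
    qed
    show "serre (q + inverse q) (Xgen Pos i m) (Xgen Pos i n) (Xgen Pos j l) \<in> relation_ideal q M N"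
      if "1 \<le> i" "i < M + N" "1 \<le> j" "j < M + N" "i = j + 1 \<or> j = i + 1" "i \<noteq> M"
    proof -
      have "cform M i j = 1 \<or> cform M i j = -1"
        using that cform_adjacent[of i M] cform_adjacent[of j M] ell_cases[of M "i + 1"] ell_cases[of M "j + 1"] by auto
      then have "relation q M N
        (br M q (Xgen Pos i m) (br M (inverse q) (Xgen Pos i n) (Xgen Pos j l)) +
         br M q (Xgen Pos i n) (br M (inverse q) (Xgen Pos i m) (Xgen Pos j l))) 0"
        using that by (intro X_Serre) auto
      note r = relation_zero_mem[OF this]
      have in_br: "br M (inverse q) (Xgen Pos i n) (Xgen Pos j l)
          = Xgen Pos i n * Xgen Pos j l - cst (inverse q) * (Xgen Pos j l * Xgen Pos i n)"
        "homogeneous M (if j = M then 1 else 0) (br M (inverse q) (Xgen Pos i n) (Xgen Pos j l))" for n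
        using br_even[OF Xgen_even[OF that(6)] homogeneous_Xgen] by simp_all
      have out_br: "br M q (Xgen Pos i m) (br M (inverse q) (Xgen Pos i n) (Xgen Pos j l))
          = Xgen Pos i m * br M (inverse q) (Xgen Pos i n) (Xgen Pos j l)
            - cst q * (br M (inverse q) (Xgen Pos i n) (Xgen Pos j l) * Xgen Pos i m)" for m n
        by (rule br_even(1)[OF Xgen_even[OF that(6)] in_br(2)]) simp
      have "br M q (Xgen Pos i m) (br M (inverse q) (Xgen Pos i n) (Xgen Pos j l)) +
         br M q (Xgen Pos i n) (br M (inverse q) (Xgen Pos i m) (Xgen Pos j l)) =
         serre (q + inverse q) (Xgen Pos i m) (Xgen Pos i n) (Xgen Pos j l)"
        unfolding out_br unfolding in_br(1) by (rule serre_brackets[OF assms(1)])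
      with r show ?thesis by simp
    qed
    show "super_serre (inverse q) q (Xgen Pos M n) (Xgen Pos (M + 1) l) (Xgen Pos (M - 1) m) \<in> relation_ideal q M N"
      if "1 < M" "M + 1 < M + N"
    proof -
      let ?Y = "Xgen Pos (M - 1) m" and ?A = "Xgen Pos M n" and ?B = "Xgen Pos (M + 1) l"
      let ?z = "br M (inverse q) ?Y ?A"
      let ?w = "br M q ?z ?B"
      \<comment> \<open>Both odd loop indices are taken to be \<open>n\<close>; the two summands
        coincide and half of the relation is kept.\<close>
      have "relation q M N (br M 1 ?w ?A + br M 1 ?w ?A) 0"
        by (rule X_super_Serre) (use that in auto)
      from relation_zero_mem[OF this] have "cst (1/2) * (br M 1 ?w ?A + br M 1 ?w ?A) \<in> relation_ideal q M N"
        by (rule J_left)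
      moreover have "cst (1/2) * (br M 1 ?w ?A + br M 1 ?w ?A) = br M 1 ?w ?A"
        using sc_two[of "br M 1 ?w ?A"] by (simp add: sc_sc sc_one flip: sc_two)
      ultimately have r: "br M 1 ?w ?A \<in> relation_ideal q M N" by simp
      have z: "?z = ?Y * ?A - cst (inverse q) * (?A * ?Y)" "homogeneous M 1 ?z"
        using br_even[OF Xgen_even Xgen_odd, of "M - 1" M] that by auto
      have w: "?w = ?z * ?B - cst q * (?B * ?z)" "homogeneous M 1 ?w"
        using br_even[OF z(2) Xgen_even, of "M + 1"] by auto
      have "br M 1 ?w ?A = ?w * ?A + ?A * ?w"
        using br_odd[OF w(2) Xgen_odd] by (simp add: cst_one)
      with r show ?thesis
        unfolding super_serre_def Let_def z(1)[symmetric] w(1)[symmetric] by (simp only:)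
    qed
  qed
qed


section \<open>The spanning set\<close>

lemma span_mem:
  "(\<And>H. submodule H complex_field A \<Longrightarrow> S \<subseteq> H \<Longrightarrow> x \<in> H) \<Longrightarrow> x \<in> span_of A S"
  by (auto simp: span_of_def hull_def)

lemma subalgebra_mem:
  "(\<And>H. submodule H complex_field A \<Longrightarrow> subring H A \<Longrightarrow> S \<subseteq> H \<Longrightarrow> x \<in> H) \<Longrightarrow> x \<in> subalgebra_of A S"
  by (auto simp: subalgebra_of_def hull_def)

lemma complex_field_carrier: "carrier complex_field = UNIV"
  by (simp add: ring_of_type_algebra_def)

lemma submodule_closed:
  assumes "submodule H complex_field (Uq q M N)"
  shows "quot q M N a \<in> H \<Longrightarrow> quot q M N b \<in> H \<Longrightarrow> quot q M N (a + b) \<in> H"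
    and "quot q M N a \<in> H \<Longrightarrow> quot q M N (cst c * a) \<in> H"
    and "a \<in> relation_ideal q M N \<Longrightarrow> quot q M N a \<in> H"
proof -
  interpret submodule H complex_field "Uq q M N" by fact
  show "quot q M N a \<in> H \<Longrightarrow> quot q M N b \<in> H \<Longrightarrow> quot q M N (a + b) \<in> H"
    using m_closed[of "quot q M N a" "quot q M N b"] by (simp add: Uq_simps quot_add)
  show "quot q M N a \<in> H \<Longrightarrow> quot q M N (cst c * a) \<in> H"
    using smult_closed[of c "quot q M N a"] by (simp add: complex_field_carrier quot_smult)
  show "a \<in> relation_ideal q M N \<Longrightarrow> quot q M N a \<in> H"
    using one_closed by (simp add: relation_ideal_def quot_rel_ideal Uq_simps)
qed

lemma subring_mult:
  "subring H (Uq q M N) \<Longrightarrow> quot q M N a \<in> H \<Longrightarrow> quot q M N b \<in> H \<Longrightarrow> quot q M N (a * b) \<in> H"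
  using subringE(6)[of H "Uq q M N"] by (simp add: Uq_simps quot_mult)

lemma subgroup_quot_image:
  assumes "0 \<in> S" "\<And>a b. a \<in> S \<Longrightarrow> b \<in> S \<Longrightarrow> a + b \<in> S" "\<And>a. a \<in> S \<Longrightarrow> - a \<in> S"
  shows "subgroup (quot q M N ` S) (add_monoid (Uq q M N))"
proof
  interpret U: ring "U_ring q M N" by (rule ring_U)
  have zero: "quot q M N 0 = \<zero>\<^bsub>U_ring q M N\<^esub>"
    using additive_subgroup.zero_closed[OF ideal.axioms(1)[OF ideal_rel_ideal]]
    by (intro quot_rel_ideal) (simp add: restrict_gens_zero free_algebra_simps)
  show "quot q M N ` S \<subseteq> carrier (add_monoid (Uq q M N))"
    using quot_closed by (auto simp: Uq_simps)
  show "x \<otimes>\<^bsub>add_monoid (Uq q M N)\<^esub> y \<in> quot q M N ` S" if "x \<in> quot q M N ` S" "y \<in> quot q M N ` S" for x y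
    using that assms(2) by (auto simp: Uq_simps simp flip: quot_add)
  show "\<one>\<^bsub>add_monoid (Uq q M N)\<^esub> \<in> quot q M N ` S"
    using assms(1) zero by (auto simp: Uq_simps image_iff)
  show "inv\<^bsub>add_monoid (Uq q M N)\<^esub> x \<in> quot q M N ` S" if "x \<in> quot q M N ` S" for x
  proof -
    obtain a where a: "a \<in> S" "x = quot q M N a" using \<open>x \<in> quot q M N ` S\<close> by blast
    \<comment> \<open>\<open>Uq\<close> is a different record with the same carrier and addition,
      and the inverse depends on these data only.\<close>
    have "inv\<^bsub>add_monoid (Uq q M N)\<^esub> x = inv\<^bsub>add_monoid (U_ring q M N)\<^esub> x"
      by (simp add: m_inv_def Uq_simps)
    moreover have "\<ominus>\<^bsub>U_ring q M N\<^esub> x = quot q M N (- a)"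
    proof (rule U.minus_equality)
      show "quot q M N (- a) \<oplus>\<^bsub>U_ring q M N\<^esub> x = \<zero>\<^bsub>U_ring q M N\<^esub>"
        using quot_add[of q M N "- a" a] zero a(2) by simp
    qed (simp_all add: a(2) quot_closed)
    ultimately have "inv\<^bsub>add_monoid (Uq q M N)\<^esub> x = quot q M N (- a)"
      by (simp only: a_inv_def)
    then show ?thesis using a assms(3) by simp
  qed
qed

lemma root_vector_fold_free_carrier:
  assumes "1 \<le> i" "i \<le> j" "j < M + N"
  shows "foldl (\<lambda>a k. br M (qi q M k) a (Xgen Pos k 0)) (Xgen Pos i n) [i + 1..<j + 1] \<in> free_carrier M N"
  using assms(2,3)
proof (induct j rule: dec_induct)
  case base
  then show ?case using assms(1) by (auto intro!: free_carrier_gvar gens_mem)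
next
  case (step j)
  then have "br M (qi q M (j + 1)) (foldl (\<lambda>a k. br M (qi q M k) a (Xgen Pos k 0)) (Xgen Pos i n) [i + 1..<j + 1])
      (Xgen Pos (j + 1) 0) \<in> free_carrier M N"
    using assms(1) by (intro free_carrier_br free_carrier_gvar gens_mem) auto
  then show ?case using step by simp
qed

text \<open>The induction carries the parity along: the vector is odd exactly when \<open>M\<close>
  is among its nodes. In that case the appended node lies beyond \<open>M\<close> and is even, so
  the sign of each bracket is trivial.\<close>

lemma quot_root_vec:
  assumes "simple_root_algebra (\<lambda>c a. cst c * a) (relation_ideal q M N) (Xgen Pos) (M + N) M k p t u v"
    and "k = qi q M" and "(i, j) \<in> roots M N"
  shows "quot q M N (simple_root_algebra.root_vec (\<lambda>c a. cst c * a) (Xgen Pos) k (i, j) n) = root_vector q M N (i, j) n"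
proof -
  interpret simple_root_algebra "\<lambda>c a. cst c * a" "relation_ideal q M N" "Xgen Pos" "M + N" M k p t u v by fact
  have i: "1 \<le> i" "i \<le> j" "j < M + N" using assms(3) by (auto simp: roots_def)
  let ?f = "\<lambda>j. foldl (\<lambda>a k. br M (qi q M k) a (Xgen Pos k 0)) (Xgen Pos i n) [i + 1..<j + 1]"
  have "?f (i + d) = root_vec (i, i + d) n \<and> homogeneous M (if i \<le> M \<and> M \<le> i + d then 1 else 0) (?f (i + d))" for d
  proof (induct d)
    case 0
    show ?case using homogeneous_Xgen[of M i Pos n] by (auto simp: root_vec_def)
  next
    case (Suc d)
    let ?s = "i + d + 1"
    have f: "?f (i + Suc d) = br M (qi q M ?s) (?f (i + d)) (Xgen Pos ?s 0)" by simp
    have r: "root_vec (i, i + Suc d) n = root_vec (i, i + d) n * Xgen Pos ?s 0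
        - cst (qi q M ?s) * (Xgen Pos ?s 0 * root_vec (i, i + d) n)"
      unfolding root_vec_def by (simp add: assms(2))
    have h: "homogeneous M (if i \<le> M \<and> M \<le> i + d then 1 else 0) (?f (i + d))" using Suc by (rule conjunct2)
    note b = br_even[OF h homogeneous_Xgen[of M ?s Pos 0], of "qi q M ?s"]
    have "br M (qi q M ?s) (?f (i + d)) (Xgen Pos ?s 0) = ?f (i + d) * Xgen Pos ?s 0 - cst (qi q M ?s) * (Xgen Pos ?s 0 * ?f (i + d))"
      by (rule b(1)) auto
    moreover have "homogeneous M ((if i \<le> M \<and> M \<le> i + d then 1 else 0) + (if ?s = M then 1 else 0)) (?f (i + Suc d))"
      unfolding f by (rule b(2)) auto
    moreover have "(if i \<le> M \<and> M \<le> i + d then 1 else 0) + (if ?s = M then 1 else 0) = (if i \<le> M \<and> M \<le> i + Suc d then 1 else (0::nat))"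
      by auto
    ultimately show ?case unfolding f r using Suc by (simp only: f)
  qed
  from this[of "j - i"] i have "?f j = root_vec (i, j) n" by simp
  moreover have "?f j \<in> free_carrier M N" by (rule root_vector_fold_free_carrier[OF i])
  ultimately show ?thesis
    using quot_free_carrier[of "?f j" M N q] by (simp add: root_vector_def)
qed

lemma finite_roots: "finite (roots M N)"
  by (rule finite_subset[of _ "{..<M + N} \<times> {..<M + N}"]) (auto simp: roots_def)


lemma monoid_Uq: "Group.monoid (Uq q M N)"
proof -
  interpret U: ring "U_ring q M N" by (rule ring_U)
  show ?thesis by (rule monoidI) (simp_all add: Uq_simps U.m_assoc)
qed

lemma root_vector_closed:
  assumes "\<beta> \<in> roots M N"
  shows "root_vector q M N \<beta> n \<in> carrier (Uq q M N)"
proof -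
  obtain i j where "\<beta> = (i, j)" "1 \<le> i" "i \<le> j" "j < M + N"
    using assms by (cases \<beta>) (auto simp: roots_def)
  then have "root_vector q M N \<beta> n = quot q M N
      (foldl (\<lambda>a k. br M (qi q M k) a (Xgen Pos k 0)) (Xgen Pos i n) [i + 1..<j + 1])"
    by (simp only: root_vector_def prod.case quot_free_carrier[OF root_vector_fold_free_carrier])
  then show ?thesis using quot_closed by (simp only: Uq_simps)
qed

lemma ordered_product_concat:
  "ordered_product q M N m n = list_product (Uq q M N)
     (concat (map (\<lambda>\<beta>. map (\<lambda>i. root_vector q M N \<beta> (n i \<beta>)) [1..<m \<beta> + 1]) (sorted_list_of_set (roots M N))))"
proof -
  have "list_product (Uq q M N) (map (list_product (Uq q M N))
      (map (\<lambda>\<beta>. map (\<lambda>i. root_vector q M N \<beta> (n i \<beta>)) [1..<m \<beta> + 1]) (sorted_list_of_set (roots M N))))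
    = list_product (Uq q M N)
     (concat (map (\<lambda>\<beta>. map (\<lambda>i. root_vector q M N \<beta> (n i \<beta>)) [1..<m \<beta> + 1]) (sorted_list_of_set (roots M N))))"
    by (rule list_product_concat[OF monoid_Uq]) (use finite_roots root_vector_closed in \<open>auto simp del: upt_Suc\<close>)
  then show ?thesis by (simp add: ordered_product_def comp_def del: upt_Suc)
qed

theorem theorem3p12:
  fixes q :: complex and M N :: nat
  assumes "q \<noteq> 0" and "\<forall>k>0. q ^ k \<noteq> 1" and "M \<ge> 1" and "N \<ge> 1"
  shows "U_plus q M N = span_of (Uq q M N) {ordered_product q M N m n | m n. True}"
proof (rule Set.equalityI)
  note algebra = simple_root_algebra_relation_ideal[OF assms(1,2), of M N]
  interpret simple_root_algebra "\<lambda>c a. cst c * a" "relation_ideal q M N" "Xgen Pos" "M + N" M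
    "qi q M" "\<lambda>i. q powi cform M i (i + 1)" "q + inverse q" "inverse q" q
    by (rule algebra)
  let ?gens = "{proj q M N (Xgen Pos i n) | i n. i \<in> {1..<M + N}}"
  let ?W = "words_from 1"
  have proj_gen: "proj q M N (Xgen Pos i n) = quot q M N (Xgen Pos i n)" if "i \<in> {1..<M + N}" for i n
    using that by (simp add: quot_free_carrier free_carrier_gvar gens_mem)
  have root_vec: "quot q M N (root_vec \<beta> n) = root_vector q M N \<beta> n" if "\<beta> \<in> roots M N" for \<beta> n
    using quot_root_vec[OF algebra refl, of "fst \<beta>" "snd \<beta>" n] that by simp
  \<comment> \<open>Induction on the right factor, because \<open>rspan\<close> extends words on the
    right.\<close>
  have W_mult: "x * y \<in> ?W" if "x \<in> ?W" "y \<in> ?W" for x y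
    using that(2) unfolding words_from_def
  proof induct
    case (J y)
    then show ?case by (intro rspan.J J_left)
  next
    case (gen y)
    then show ?case using that(1) by (simp add: words_from_def)
  next
    case (add y z)
    then show ?case by (simp add: distrib_left rspan.add)
  next
    case (sc y c)
    then show ?case by (simp add: mult_sc_right rspan.sc)
  next
    case (right y z)
    then show ?case unfolding mult.assoc[symmetric] by - (rule rspan.right)
  qed
  \<comment> \<open>The image of \<open>words_from 1\<close> is shown to be a subalgebra containing
    the generators; minimality of the hull then places \<open>U_plus\<close> inside it.\<close>
  have sub: "subgroup (quot q M N ` ?W) (add_monoid (Uq q M N))"
    by (rule subgroup_quot_image) (simp_all add: words_from_def rspan_zero rspan.add rspan_minus)
  have "submodule (quot q M N ` ?W) complex_field (Uq q M N)"
    using sub by (intro submodule.intro submodule_axioms.intro)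
      (auto simp: quot_smult words_from_def intro!: imageI rspan.sc)
  moreover have "submonoid (quot q M N ` ?W) (Uq q M N)"
  proof
    show "quot q M N ` ?W \<subseteq> carrier (Uq q M N)" using quot_closed by (auto simp: Uq_simps)
    show "x \<otimes>\<^bsub>Uq q M N\<^esub> y \<in> quot q M N ` ?W" if "x \<in> quot q M N ` ?W" "y \<in> quot q M N ` ?W" for x y
      using that W_mult by (auto simp: Uq_simps simp flip: quot_mult)
    show "\<one>\<^bsub>Uq q M N\<^esub> \<in> quot q M N ` ?W"
      using words_from_one[of 1] by (auto simp: Uq_simps simp flip: quot_one)
  qed
  moreover have "?gens \<subseteq> quot q M N ` ?W"
  proof
    fix x assume "x \<in> ?gens"
    then obtain i n where x: "x = quot q M N (Xgen Pos i n)" "i \<in> {1..<M + N}" using proj_gen by blast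
    have "1 * Xgen Pos i n \<in> ?W"
      unfolding words_from_def by (intro rspan.right rspan.gen) (use x(2) in auto)
    then show "x \<in> quot q M N ` ?W" using x(1) by simp
  qed
  ultimately have "U_plus q M N \<subseteq> quot q M N ` ?W"
    unfolding U_plus_def subalgebra_of_def using sub by (intro hull_minimal) (simp_all add: subring.intro)
  moreover have "quot q M N x \<in> span_of (Uq q M N) {ordered_product q M N m n | m n. True}" if "x \<in> ?W" for x
  proof (rule span_mem)
    fix H assume H: "submodule H complex_field (Uq q M N)" "{ordered_product q M N m n | m n. True} \<subseteq> H"
    have "x \<in> rspan {} (root_prod ` ordered_from 1)"
      using words_from_subset_ordered[of 1] assms that by auto
    then show "quot q M N x \<in> H"
    proof induct
      case (gen x)
      then obtain l where l: "x = root_prod l" "l \<in> ordered_from 1" by blast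
      then have roots: "fst ` set l \<subseteq> roots M N" and sorted: "sorted (map fst l)"
        by (auto simp: ordered_from_def roots_def)
      obtain m n where mn: "concat (map (\<lambda>\<beta>. map (\<lambda>i. root_vector q M N \<beta> (n i \<beta>)) [1..<m \<beta> + 1]) (sorted_list_of_set (roots M N)))
          = map (\<lambda>(\<beta>, c). root_vector q M N \<beta> c) l"
        using sorted_list_blocks[OF finite_roots sorted roots] by blast
      have "quot q M N (root_prod l) = list_product (Uq q M N) (map (\<lambda>(\<beta>, c). root_vector q M N \<beta> c) l)"
        using roots
        by (induct l) (auto simp: root_prod_def list_product_def quot_one quot_mult Uq_simps root_vec)
      also have "\<dots> = ordered_product q M N m n" by (simp only: ordered_product_concat mn)
      finally show ?case using H(2) l(1) by auto
    next
      case (J x)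
      then show ?case by (rule submodule_closed(3)[OF H(1)])
    next
      case (add x y)
      then show ?case by (intro submodule_closed(1)[OF H(1)])
    next
      case (sc x c)
      then show ?case by (intro submodule_closed(2)[OF H(1)])
    qed simp
  qed
  ultimately show "U_plus q M N \<subseteq> span_of (Uq q M N) {ordered_product q M N m n | m n. True}" by blast
  \<comment> \<open>For the reverse inclusion: root vectors are iterated q-commutators of
    generators, so every subalgebra containing the generators contains their products.\<close>
  have "ordered_product q M N m n \<in> H"
    if H: "submodule H complex_field (Uq q M N)" "subring H (Uq q M N)" "?gens \<subseteq> H" for H m n
  proof -
    have gens: "quot q M N (Xgen Pos i n) \<in> H" if "i \<in> {1..<M + N}" for i n
    proof -
      have "proj q M N (Xgen Pos i n) \<in> H" using H(3) that by blast
      then show ?thesis using proj_gen[OF that] by simp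
    qed
    have fold: "quot q M N (foldl (\<lambda>a l. a * Xgen Pos l 0 - cst (qi q M l) * (Xgen Pos l 0 * a)) a js) \<in> H"
      if "quot q M N a \<in> H" "set js \<subseteq> {1..<M + N}" for a js
      using that
    proof (induct js arbitrary: a)
      case (Cons j js)
      have X: "quot q M N (Xgen Pos j 0) \<in> H" using gens Cons(3) by simp
      \<comment> \<open>The difference is written as a sum with scalar -q_j, to match closure under
        sums and scalar multiples.\<close>
      have "quot q M N (a * Xgen Pos j 0 + cst (- qi q M j) * (Xgen Pos j 0 * a)) \<in> H"
        by (intro submodule_closed[OF H(1)] subring_mult[OF H(2)] X Cons(2))
      then have "quot q M N (a * Xgen Pos j 0 - cst (qi q M j) * (Xgen Pos j 0 * a)) \<in> H"
        by (simp add: cst_minus)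
      then show ?case using Cons by simp
    qed simp
    have "root_vector q M N \<beta> n \<in> H" if "\<beta> \<in> roots M N" for \<beta> n
    proof -
      obtain i j where \<beta>: "\<beta> = (i, j)" "1 \<le> i" "i \<le> j" "j < M + N" 
        using \<open>\<beta> \<in> roots M N\<close> by (cases \<beta>) (auto simp: roots_def)
      have "quot q M N (root_vec (i, j) n) \<in> H"
        unfolding root_vec_def prod.case by (rule fold[OF gens]) (use \<beta> in auto)
      then show ?thesis using root_vec[OF that] \<beta>(1) by simp
    qed
    then have "set (concat (map (\<lambda>\<beta>. map (\<lambda>i. root_vector q M N \<beta> (n i \<beta>)) [1..<m \<beta> + 1]) (sorted_list_of_set (roots M N)))) \<subseteq> H"
      using finite_roots by (auto simp del: upt_Suc)
    moreover have "list_product (Uq q M N) xs \<in> H" if "set xs \<subseteq> H" for xs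
      using that subringE(3,6)[OF H(2)] by (induct xs) (auto simp: list_product_def)
    ultimately show ?thesis unfolding ordered_product_concat by blast
  qed
  then have "span_of (Uq q M N) {ordered_product q M N m n | m n. True} \<subseteq> H"
    if "submodule H complex_field (Uq q M N)" "subring H (Uq q M N)" "?gens \<subseteq> H" for H
    unfolding span_of_def using that by (intro hull_minimal) blast+
  then show "span_of (Uq q M N) {ordered_product q M N m n | m n. True} \<subseteq> U_plus q M N"
    unfolding U_plus_def by (intro subsetI subalgebra_mem) (rule subsetD)
qed

end
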